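(* Let $f\in L^1(m)$ be non-negative and suppose that there exist $x_0\in(0,1)$ and $\alpha\in[0,1)$ such that $$0<\inf_{x\in(0,x_0)}x^\alpha f(x)\leq\sup_{x\in(0,1)}x^\alpha f(x)<+\infty .$$ Then $$\mu_f(\mathring{I}^t)\approx t^{-\frac{1-\alpha}{\gamma}} .$$ Consequently, the measure $\mu_f$ has polynomial escape rate $\mathfrak{e}_{\mathrm{poly}}(\mu_f)=\frac{1-\alpha}{\gamma}$.
   Context: Fix $0<\gamma<1$. Let $I=[0,1)$, let $m$ be Lebesgue measure on $I$, and let $T:I\to I$ be given by $T(x)=x+2^\gamma x^{\gamma+1}$ for $x\in[0,\tfrac12)$ and $T(x)=2x-1$ for $x\in[\tfrac12,1)$. Let $T_L$ be the left branch of $T$ (its restriction to $[0,\tfrac12)$, extended by its formula) and $a_n=T_L^{-n}(\tfrac12)$, so $a_0=\tfrac12$ and $a_n\downarrow 0$. Let $\mathcal{P}=\{J_L,J_R\}$ with $J_L=[0,\tfrac12)$, $J_R=[\tfrac12,1)$, and $\mathcal{J}=\{J_n\}_{n\geq0}$ with $J_0=J_R$ and $J_n=[a_n,a_{n-1})$ for $n\geq1$. For $t\geq0$ let $\mathcal{J}^{(t)}=\mathcal{J}\vee\bigvee_{i=0}^tT^{-i}(\mathcal{P})$, where $\vee$ denotes the common refinement of partitions (non-empty intersections). The hole $H$ is a fixed, arbitrary element of $\mathcal{J}^{(\ell_H)}$, where $\ell_H\geq0$ is an arbitrary integer. For $t\geq0$ let $\mathring{I}^t=\bigcap_{i=0}^tT^{-i}(I\setminus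 H)$ be the set of points that have not entered $H$ up to time $t$. For $f\in L^1(m)$, $\mu_f$ is the measure with density $f$ with respect to $m$. For a measure $\mu$, the polynomial rate of escape is $\mathfrak{e}_{\mathrm{poly}}(\mu)=-\lim_{t\to+\infty}\frac{\log\mu(\mathring{I}^t)}{\log t}$ whenever the limit exists. The notation $u_t\approx v_t$ means that there is $C>0$, independent of $t$, such that $C^{-1}v_t\leq u_t\leq Cv_t$ for all $t\geq1$. *)

theory Defs
  imports "HOL-Analysis.Analysis"
begin

definition II :: "real set" where
  "II = {0..<1}"

definition leb :: "real measure" where
  "leb = lebesgue_on II"

text \<open>The left branch extended by its formula; \<open>0 powr (\<gamma> + 1) = 0\<close>, so it fixes \<open>0\<close>.\<close>

definition TL :: "real \<Rightarrow> real \<Rightarrow> real" where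
  "TL \<gamma> x = x + 2 powr \<gamma> * x powr (\<gamma> + 1)"

text \<open>Only the values of \<open>T\<close> on \<open>II\<close> are relevant; there it is a self-map.\<close>

definition T :: "real \<Rightarrow> real \<Rightarrow> real" where
  "T \<gamma> x = (if x < 1/2 then TL \<gamma> x else 2 * x - 1)"

text \<open>\<open>TL \<gamma>\<close> is an increasing bijection from \<open>[0, 1/2]\<close> onto \<open>[0, 1]\<close>, so its inverse may be
  iterated on \<open>[0, 1]\<close>.\<close>

definition a_seq :: "real \<Rightarrow> nat \<Rightarrow> real" where
  "a_seq \<gamma> n = (inv_into {0..1/2} (TL \<gamma>) ^^ n) (1/2)"

definition preim :: "real \<Rightarrow> nat \<Rightarrow> real set \<Rightarrow> real set" where
  "preim \<gamma> i A = {x \<in> II. (T \<gamma> ^^ i) x \<in> A}"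

definition refine2 :: "'a set set \<Rightarrow> 'a set set \<Rightarrow> 'a set set" where
  "refine2 P Q = {A \<inter> B | A B. A \<in> P \<and> B \<in> Q \<and> A \<inter> B \<noteq> {}}"

definition refine_upto :: "nat \<Rightarrow> (nat \<Rightarrow> 'a set set) \<Rightarrow> 'a set set" where
  "refine_upto t P = {\<Inter>i\<le>t. A i | A. (\<forall>i\<le>t. A i \<in> P i) \<and> (\<Inter>i\<le>t. A i) \<noteq> {}}"

definition part_P :: "real set set" where
  "part_P = {{0..<1/2}, {1/2..<1}}"

text \<open>These sets partition \<open>(0, 1)\<close>: the neutral fixed point \<open>0\<close> lies in none of them.\<close>

definition J_elem :: "real \<Rightarrow> nat \<Rightarrow> real set" where
  "J_elem \<gamma> n = (case n of 0 \<Rightarrow> {1/2..<1} | Suc k \<Rightarrow> {a_seq \<gamma> (Suc k)..<a_seq \<gamma> k})"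

definition part_J :: "real \<Rightarrow> real set set" where
  "part_J \<gamma> = range (J_elem \<gamma>)"

definition part_Jt :: "real \<Rightarrow> nat \<Rightarrow> real set set" where
  "part_Jt \<gamma> t = refine2 (part_J \<gamma>) (refine_upto t (\<lambda>i. preim \<gamma> i ` part_P))"

definition survivors :: "real \<Rightarrow> real set \<Rightarrow> nat \<Rightarrow> real set" where
  "survivors \<gamma> H t = (\<Inter>i\<le>t. preim \<gamma> i (II - H))"

definition mu :: "(real \<Rightarrow> real) \<Rightarrow> real measure" where
  "mu f = density leb (\<lambda>x. ennreal (f x))"

definition approx_equiv :: "(nat \<Rightarrow> real) \<Rightarrow> (nat \<Rightarrow> real) \<Rightarrow> bool" where
  "approx_equiv u v \<longleftrightarrow> (\<exists>C>0. \<forall>t\<ge>1. inverse C * v t \<le> u t \<and> u t \<le> C * v t)"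

definition log_ratio :: "real \<Rightarrow> real set \<Rightarrow> real measure \<Rightarrow> nat \<Rightarrow> real" where
  "log_ratio \<gamma> H M t = ln (measure M (survivors \<gamma> H t)) / ln (real t)"

definition has_escape_rate :: "real \<Rightarrow> real set \<Rightarrow> real measure \<Rightarrow> bool" where
  "has_escape_rate \<gamma> H M \<longleftrightarrow> convergent (log_ratio \<gamma> H M)"

text \<open>Meaningful only if \<open>has_escape_rate \<gamma> H M\<close> holds.\<close>

definition e_poly :: "real \<Rightarrow> real set \<Rightarrow> real measure \<Rightarrow> real" where
  "e_poly \<gamma> H M = - lim (log_ratio \<gamma> H M)"

end

theory Submission
  imports Defs
begin

text \<open>
  Near the neutral fixed point \<open>0\<close> the inverse left branch \<open>\<psi>\<close> moves points so slowly that
  \<open>\<psi>\<^sup>n(1)\<close> has order \<open>n\<^sup>-\<^sup>1\<^sup>/\<^sup>\<gamma>\<close> (\<open>b_le\<close>, \<open>b_ge\<close>). Points below \<open>\<psi>\<^sup>t\<^sup>+\<^sup>k(1)\<close> need more than \<open>t\<close> steps to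
  reach a hole above \<open>\<psi>\<^sup>k(1)\<close>, and a density of order \<open>x\<^sup>-\<^sup>\<alpha>\<close> gives them mass of order
  \<open>t\<^sup>-\<^sup>(\<^sup>1\<^sup>-\<^sup>\<alpha>\<^sup>)\<^sup>/\<^sup>\<gamma>\<close>. This is the lower bound. The upper bound says that this initial layer is the only
  obstacle: an orbit that has once left it is lost at the faster rate \<open>t\<^sup>-\<^sup>1\<^sup>/\<^sup>\<gamma>\<close>.

  Distortion is controlled without any estimate of second derivatives. Non-negative densities \<open>g\<close> on
  \<open>(0,1)\<close> that decrease while \<open>x\<^sup>\<gamma>\<^sup>+\<^sup>1 g(x)\<close> increases form the cone of Liverani, Saussol and Vaienti.
  Not only the transfer operator of \<open>T\<close> but the contribution of each single branch preserves this
  cone (\<open>cone_PL\<close>, \<open>cone_PR\<close>), and it contains \<open>x\<^sup>-\<^sup>\<alpha>\<close>. A step through the right branch sees only the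
  part of the density on \<open>[1/2,1)\<close>, where the two monotonicities compare all values up to the factor
  \<open>K = 2\<^sup>\<gamma>\<^sup>+\<^sup>1\<close>; so each passage through the right half resets the density to a balanced one
  (\<open>balanced_PR\<close>).

  The hole is determined by the first \<open>N\<close> left-right symbols of the orbit, for some \<open>N\<close>. So a
  balanced density gives it a definite proportion of the mass (\<open>mass_avoiding_le\<close>), and what survives
  and is pushed forward by \<open>T\<^sup>N\<close> is a sum of single-branch contributions, again in the cone
  (\<open>restricted_pushforward\<close>). Waiting for the next passage through the right half, during at most \<open>k\<close>
  steps, yields another balanced density, up to the mass in \<open>(0, \<psi>\<^sup>k(1))\<close>
  (\<open>mass_excursion\<close>). If \<open>u\<^sub>t\<close> is the largest surviving proportion at time \<open>t\<close> over all
  balanced densities, then \<open>u\<^sub>t \<le> \<rho> u\<^sub>t\<^sub>-\<^sub>N\<^sub>-\<^sub>k + D (k+1)\<^sup>-\<^sup>1\<^sup>/\<^sup>\<gamma>\<close> with \<open>\<rho> < 1\<close> (\<open>renewal_step\<close>). Taking \<open>k\<close> to be a small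
  proportion of \<open>t\<close> gives \<open>u\<^sub>t = O(t\<^sup>-\<^sup>1\<^sup>/\<^sup>\<gamma>)\<close> (\<open>renewal_decay\<close>). One last use of \<open>mass_excursion\<close>, for the density
  \<open>x\<^sup>-\<^sup>\<alpha>\<close> and \<open>k\<close> about \<open>t/2\<close>, gives the upper bound (\<open>powr_survival_upper\<close>).
\<close>

locale neutral_map =
  fixes \<gamma> :: real
  assumes \<gamma>_pos: "0 < \<gamma>" and \<gamma>_less_1: "\<gamma> < 1"
begin

section \<open>The branches and their inverses\<close>

definition TL' :: "real \<Rightarrow> real" where
  "TL' x = 1 + (\<gamma> + 1) * 2 powr \<gamma> * x powr \<gamma>"

definition \<psi> :: "real \<Rightarrow> real" where
  "\<psi> = inv_into {0..1/2} (TL \<gamma>)"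

text \<open>
  The orbit starts at \<open>1\<close> and not at \<open>1/2 = \<psi> 1\<close>, so that \<open>[0, b n)\<close> consists of the points of
  \<open>[0, 1)\<close> that spend the times \<open>0, \<dots>, n - 1\<close> in the left half.
\<close>

definition b :: "nat \<Rightarrow> real" where
  "b n = (\<psi> ^^ n) 1"

lemma TL_factor:
  assumes "0 \<le> x"
  shows "TL \<gamma> x = x * (1 + (2 * x) powr \<gamma>)"
  using assms \<gamma>_pos by (cases "x = 0") (auto simp: TL_def powr_add powr_mult field_simps)

lemma TL'_alt:
  assumes "0 \<le> x"
  shows "TL' x = 1 + (\<gamma> + 1) * (2 * x) powr \<gamma>"
  using assms by (auto simp: TL'_def powr_mult)

lemma TL_0 [simp]: "TL \<gamma> 0 = 0"
  using \<gamma>_pos by (simp add: TL_def)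

lemma TL_half [simp]: "TL \<gamma> (1/2) = 1"
  by (subst TL_factor) auto

lemma TL_strict_mono:
  assumes "0 \<le> x" "x < y"
  shows "TL \<gamma> x < TL \<gamma> y"
proof -
  have "x powr (\<gamma> + 1) \<le> y powr (\<gamma> + 1)"
    using assms \<gamma>_pos by (intro powr_mono2) auto
  thus ?thesis using assms(2)
    unfolding TL_def by (intro add_less_le_mono mult_left_mono) auto
qed

lemma TL_less_iff:
  assumes "0 \<le> x" "0 \<le> y"
  shows "TL \<gamma> x < TL \<gamma> y \<longleftrightarrow> x < y"
  using assms TL_strict_mono by (metis linorder_less_linear order_less_asym)

lemma TL_ge: "0 \<le> x \<Longrightarrow> x \<le> TL \<gamma> x"
  by (simp add: TL_def)

lemma TL'_ge_1: "1 \<le> TL' x"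
  using \<gamma>_pos by (auto simp: TL'_def)

lemma TL'_mono:
  assumes "0 \<le> x" "x \<le> y"
  shows "TL' x \<le> TL' y"
proof -
  have "x powr \<gamma> \<le> y powr \<gamma>"
    using assms \<gamma>_pos by (intro powr_mono2) auto
  thus ?thesis unfolding TL'_def using \<gamma>_pos
    by (intro add_left_mono mult_left_mono) auto
qed

lemma TL'_le_3:
  assumes "0 \<le> x" "x \<le> 1/2"
  shows "TL' x \<le> 3"
proof -
  have "TL' x \<le> TL' (1/2)" using assms by (intro TL'_mono) auto
  also have "\<dots> \<le> 3" using \<gamma>_less_1 by (subst TL'_alt) auto
  finally show ?thesis .
qed

text \<open>
  The derivative at the endpoint \<open>0\<close> is needed on both sides because substitution in integrals asks
  for it on a closed interval.
\<close>

lemma TL_has_derivative: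
  assumes "0 \<le> x"
  shows "(TL \<gamma> has_real_derivative TL' x) (at x)"
proof (cases "x = 0")
  case False
  thus ?thesis using assms unfolding TL_def [abs_def] TL'_def
    by (auto intro!: derivative_eq_intros)
next
  case True
  have "((\<lambda>h::real. \<bar>h\<bar>) \<longlongrightarrow> 0) (at 0)"
    by (rule tendsto_rabs_zero) (rule tendsto_ident_at)
  hence "((\<lambda>h::real. \<bar>h\<bar> powr \<gamma>) \<longlongrightarrow> 0) (at 0)"
    by (rule tendsto_zero_powrI[where b = \<gamma>]) (use \<gamma>_pos in auto)
  hence "((\<lambda>h::real. \<bar>h powr (\<gamma> + 1) / h\<bar>) \<longlongrightarrow> 0) (at 0)"
  proof (rule Lim_transform_eventually)
    \<comment> \<open>at a negative argument \<open>powr\<close> takes the power of the absolute value\<close>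
    have "\<bar>h\<bar> powr \<gamma> = \<bar>h powr (\<gamma> + 1) / h\<bar>" if "h \<noteq> 0" for h :: real
    proof -
      have "h powr (\<gamma> + 1) = \<bar>h\<bar> powr (\<gamma> + 1)"
        by (simp add: powr_def abs_if ln_minus)
      thus ?thesis using that by (simp add: powr_add abs_mult)
    qed
    thus "\<forall>\<^sub>F h::real in at 0. \<bar>h\<bar> powr \<gamma> = \<bar>h powr (\<gamma> + 1) / h\<bar>"
      by (auto simp: eventually_at_filter)
  qed
  hence "((\<lambda>h::real. h powr (\<gamma> + 1) / h) \<longlongrightarrow> 0) (at 0)"
    by (rule tendsto_rabs_zero_cancel)
  hence "((\<lambda>h::real. 1 + 2 powr \<gamma> * (h powr (\<gamma> + 1) / h)) \<longlongrightarrow> 1 + 2 powr \<gamma> * 0) (at 0)"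
    by (intro tendsto_intros)
  hence "((\<lambda>h. (TL \<gamma> (0 + h) - TL \<gamma> 0) / h) \<longlongrightarrow> 1 + 2 powr \<gamma> * 0) (at 0)"
    by (rule Lim_transform_eventually) (auto simp: eventually_at_filter TL_def field_simps)
  moreover have "TL' x = 1" using \<gamma>_pos True by (simp add: TL'_def)
  ultimately show ?thesis using True by (simp add: DERIV_def)
qed

lemma continuous_on_TL': "continuous_on {0..1/2} TL'"
  unfolding TL'_def [abs_def] using \<gamma>_pos by (intro continuous_intros continuous_on_powr') auto

lemma TL_surj:
  assumes "y \<in> {0..1}"
  obtains x where "x \<in> {0..1/2}" "TL \<gamma> x = y"
proof -
  have "continuous_on {0..1/2} (TL \<gamma>)"
    using TL_has_derivative by (intro DERIV_continuous_on[where D = TL'])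
      (auto intro: has_field_derivative_at_within)
  then obtain x where "0 \<le> x" "x \<le> 1/2" "TL \<gamma> x = y"
    using IVT'[of "TL \<gamma>" 0 y "1/2"] assms by auto
  thus ?thesis using that by auto
qed

lemma \<psi>_props:
  assumes "y \<in> {0..1}"
  shows \<psi>_mem: "\<psi> y \<in> {0..1/2}" and TL_\<psi>: "TL \<gamma> (\<psi> y) = y"
proof -
  obtain x where "x \<in> {0..1/2}" "TL \<gamma> x = y" using TL_surj assms by blast
  hence y: "y \<in> TL \<gamma> ` {0..1/2}" by blast
  show "\<psi> y \<in> {0..1/2}" unfolding \<psi>_def by (rule inv_into_into[OF y])
  show "TL \<gamma> (\<psi> y) = y" unfolding \<psi>_def by (rule f_inv_into_f[OF y])
qed

lemma TL_inj_on: "inj_on (TL \<gamma>) {0..1/2}"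
  by (rule inj_onI) (metis TL_strict_mono atLeastAtMost_iff linorder_less_linear order_less_irrefl)

lemma \<psi>_TL: "x \<in> {0..1/2} \<Longrightarrow> \<psi> (TL \<gamma> x) = x"
  unfolding \<psi>_def by (rule inv_into_f_f[OF TL_inj_on])

lemma \<psi>_less_iff:
  assumes "x \<in> {0..1}" "y \<in> {0..1}"
  shows "\<psi> x < \<psi> y \<longleftrightarrow> x < y"
  using TL_less_iff[of "\<psi> x" "\<psi> y"] \<psi>_props[OF assms(1)] \<psi>_props[OF assms(2)] by auto

lemma \<psi>_1: "\<psi> 1 = 1/2"
  using \<psi>_TL[of "1/2"] by simp

lemma \<psi>_0: "\<psi> 0 = 0"
  using \<psi>_TL[of 0] by simp

lemma \<psi>_le_iff:
  assumes "x \<in> {0..1}" "y \<in> {0..1}"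
  shows "\<psi> x \<le> \<psi> y \<longleftrightarrow> x \<le> y"
  using \<psi>_less_iff[OF assms(2,1)] by linarith

lemma \<psi>_bounds:
  assumes "x \<in> {0<..<1}"
  shows "0 < \<psi> x" "\<psi> x < 1/2"
  using \<psi>_less_iff[of 0 x] \<psi>_less_iff[of x 1] assms by (auto simp: \<psi>_1 \<psi>_0)

lemma T_left: "x < 1/2 \<Longrightarrow> T \<gamma> x = TL \<gamma> x"
  by (simp add: T_def)

lemma T_right: "1/2 \<le> x \<Longrightarrow> T \<gamma> x = 2 * x - 1"
  by (simp add: T_def)

lemma T_II:
  assumes "x \<in> II"
  shows "T \<gamma> x \<in> II"
proof (cases "x < 1/2")
  case True
  have "TL \<gamma> x < 1" "0 \<le> TL \<gamma> x"
    using TL_strict_mono[of x "1/2"] TL_ge[of x] assms True by (auto simp: II_def)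
  thus ?thesis using True by (simp add: T_def II_def)
qed (use assms in \<open>auto simp: T_def II_def\<close>)

lemma T_pow_II: "x \<in> II \<Longrightarrow> (T \<gamma> ^^ i) x \<in> II"
  by (induction i) (auto intro: T_II)

lemma T_\<psi>:
  assumes "x \<in> II"
  shows "\<psi> x \<in> II" "\<psi> x < 1/2" "T \<gamma> (\<psi> x) = x"
  using \<psi>_less_iff[of x 1] \<psi>_props[of x] assms by (auto simp: \<psi>_1 II_def T_left)

lemma T_measurable [measurable]: "T \<gamma> \<in> borel_measurable borel"
  unfolding T_def [abs_def] TL_def by measurable

lemma T_pow_measurable [measurable]: "T \<gamma> ^^ i \<in> borel_measurable borel"
  by (induction i) (auto simp: id_def)

section \<open>Preimages accumulating at the neutral fixed point\<close>

lemma b_0 [simp]: "b 0 = 1"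
  by (simp add: b_def)

lemma b_Suc: "b (Suc n) = \<psi> (b n)"
  by (simp add: b_def)

lemma b_1: "b (Suc 0) = 1/2"
  by (simp add: b_Suc \<psi>_1)

lemma a_seq_eq: "a_seq \<gamma> n = b (Suc n)"
  unfolding a_seq_def b_def \<psi>_def[symmetric] funpow_Suc_right by (simp add: \<psi>_1)

lemma b_bounds: "0 < b n \<and> b n \<le> 1"
proof (induction n)
  case (Suc n)
  hence "\<psi> 0 < \<psi> (b n)" by (subst \<psi>_less_iff) auto
  moreover have "\<psi> (b n) \<in> {0..1/2}" using Suc by (intro \<psi>_mem) auto
  ultimately show ?case by (simp add: b_Suc \<psi>_0)
qed auto

lemma b_pos: "0 < b n" and b_le_1: "b n \<le> 1"
  using b_bounds by auto

lemma b_Suc_le_half: "b (Suc n) \<le> 1/2"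
  using \<psi>_mem[of "b n"] b_bounds[of n] by (auto simp: b_Suc)

lemma TL_b_Suc: "TL \<gamma> (b (Suc n)) = b n"
  using TL_\<psi>[of "b n"] b_bounds[of n] by (auto simp: b_Suc)

lemma b_Suc_le: "b (Suc n) \<le> b n"
  using TL_ge[of "b (Suc n)"] b_bounds[of "Suc n"] by (simp add: TL_b_Suc)

lemma b_antimono: "m \<le> n \<Longrightarrow> b n \<le> b m"
  by (rule lift_Suc_antimono_le[of b]) (auto intro: b_Suc_le)

text \<open>
  In the coordinate \<open>x\<^sup>-\<^sup>\<gamma>\<close> the inverse branch is a translation up to bounded factors. Indeed, with
  \<open>y = \<psi> x\<close> the mean value theorem gives
  \<open>y\<^sup>-\<^sup>\<gamma> - x\<^sup>-\<^sup>\<gamma> = \<gamma> \<xi>\<^sup>-\<^sup>\<gamma>\<^sup>-\<^sup>1 (x - y)\<close> for some \<open>\<xi>\<close> between \<open>y\<close> and \<open>x\<close>, where \<open>x - y = 2\<^sup>\<gamma> y\<^sup>\<gamma>\<^sup>+\<^sup>1\<close> and \<open>x \<le> 2 y\<close>.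
\<close>

lemma b_powr_step:
  "\<gamma> / 2 \<le> b (Suc n) powr (-\<gamma>) - b n powr (-\<gamma>)"
  "b (Suc n) powr (-\<gamma>) - b n powr (-\<gamma>) \<le> \<gamma> * 2 powr \<gamma>"
proof -
  define y where "y = b (Suc n)"
  define x where "x = b n"
  have y: "0 < y" "y \<le> 1/2" using b_bounds b_Suc_le_half by (auto simp: y_def)
  have x: "x = TL \<gamma> y" by (simp add: x_def y_def TL_b_Suc)
  have "(2 * y) powr \<gamma> \<le> 1" using y \<gamma>_pos by (intro powr_le1) auto
  hence "x \<le> 2 * y" unfolding x using y by (subst TL_factor) (auto simp: algebra_simps)
  have diff: "x - y = 2 powr \<gamma> * y powr (\<gamma> + 1)" by (simp add: x TL_def)
  moreover have "0 < y powr (\<gamma> + 1)" using y by simp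
  ultimately have "0 < x - y" by simp
  hence "y < x" by simp
  have deriv: "((\<lambda>z. z powr (-\<gamma>)) has_real_derivative -\<gamma> * z powr (-\<gamma> - 1)) (at z)"
    if "y \<le> z" for z
    using that y by (auto intro!: derivative_eq_intros)
  have "\<exists>z>y. z < x \<and> x powr (-\<gamma>) - y powr (-\<gamma>) = (x - y) * (-\<gamma> * z powr (-\<gamma> - 1))"
    by (rule MVT2[OF \<open>y < x\<close>]) (rule deriv)
  then obtain \<xi> where \<xi>: "y < \<xi>" "\<xi> < x" 
     and mvt: "x powr (-\<gamma>) - y powr (-\<gamma>) = (x - y) * (-\<gamma> * \<xi> powr (-\<gamma> - 1))"
    by blast
  have "y powr (-\<gamma>) - x powr (-\<gamma>) = (x - y) * (\<gamma> * \<xi> powr (-\<gamma> - 1))"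
    using mvt by (simp add: algebra_simps)
  also have "\<dots> = \<gamma> * 2 powr \<gamma> * (y powr (\<gamma> + 1) * \<xi> powr (- (\<gamma> + 1)))"
    by (simp add: diff)
  also have "y powr (\<gamma> + 1) * \<xi> powr (- (\<gamma> + 1)) = (y / \<xi>) powr (\<gamma> + 1)"
    using y \<xi> by (simp only: powr_divide powr_minus) (simp add: field_simps)
  finally have eq: "y powr (-\<gamma>) - x powr (-\<gamma>) = \<gamma> * 2 powr \<gamma> * (y / \<xi>) powr (\<gamma> + 1)" .
  have "(y / \<xi>) powr (\<gamma> + 1) \<le> 1"
    using y \<xi> \<gamma>_pos by (intro powr_le1) auto
  hence "\<gamma> * 2 powr \<gamma> * (y / \<xi>) powr (\<gamma> + 1) \<le> \<gamma> * 2 powr \<gamma> * 1"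
    using \<gamma>_pos by (intro mult_left_mono) auto
  thus "b (Suc n) powr (-\<gamma>) - b n powr (-\<gamma>) \<le> \<gamma> * 2 powr \<gamma>"
    using eq by (simp add: x_def y_def)
  have "(1/2) powr (\<gamma> + 1) \<le> (y / \<xi>) powr (\<gamma> + 1)"
    using y \<xi> \<gamma>_pos \<open>x \<le> 2 * y\<close> by (intro powr_mono2) (auto simp: field_simps)
  hence "\<gamma> * 2 powr \<gamma> * (1/2) powr (\<gamma> + 1) \<le> \<gamma> * 2 powr \<gamma> * (y / \<xi>) powr (\<gamma> + 1)"
    using \<gamma>_pos by (intro mult_left_mono) auto
  also have "\<gamma> * 2 powr \<gamma> * (1/2) powr (\<gamma> + 1) = \<gamma> / 2"
    by (simp add: powr_divide powr_add)
  finally show "\<gamma> / 2 \<le> b (Suc n) powr (-\<gamma>) - b n powr (-\<gamma>)"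
    using eq by (simp add: x_def y_def)
qed

lemma b_powr_bounds: "\<gamma> / 2 * (real n + 1) \<le> b n powr (-\<gamma>)" "b n powr (-\<gamma>) \<le> 2 * (real n + 1)"
proof -
  have "1 + \<gamma> / 2 * real n \<le> b n powr (-\<gamma>) \<and> b n powr (-\<gamma>) \<le> 1 + \<gamma> * 2 powr \<gamma> * real n"
  proof (induction n)
    case (Suc n)
    thus ?case using b_powr_step[of n] by (simp add: algebra_simps add_divide_distrib)
  qed auto
  moreover have "\<gamma> * 2 powr \<gamma> \<le> 1 * 2 powr 1"
    using \<gamma>_less_1 \<gamma>_pos by (intro mult_mono powr_mono) auto
  hence "\<gamma> * 2 powr \<gamma> * real n \<le> 2 * real n" by (intro mult_right_mono) auto
  ultimately show "\<gamma> / 2 * (real n + 1) \<le> b n powr (-\<gamma>)" "b n powr (-\<gamma>) \<le> 2 * (real n + 1)"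
    using \<gamma>_less_1 by (simp_all add: algebra_simps)
qed

lemma b_eq: "b n = (b n powr (-\<gamma>)) powr (-1/\<gamma>)"
  using b_pos[of n] \<gamma>_pos by (simp add: powr_powr)

lemma b_le: "b n \<le> (\<gamma> / 2) powr (-1/\<gamma>) * (real n + 1) powr (-1/\<gamma>)"
proof -
  have "b n \<le> (\<gamma> / 2 * (real n + 1)) powr (-1/\<gamma>)"
    using b_powr_bounds(1)[of n] \<gamma>_pos by (subst b_eq) (auto intro: powr_mono2')
  also have "\<dots> = (\<gamma> / 2) powr (-1/\<gamma>) * (real n + 1) powr (-1/\<gamma>)"
    by (rule powr_mult)
  finally show ?thesis .
qed

lemma b_ge: "2 powr (-1/\<gamma>) * (real n + 1) powr (-1/\<gamma>) \<le> b n"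
proof -
  have "(2 * (real n + 1)) powr (-1/\<gamma>) \<le> (b n powr (-\<gamma>)) powr (-1/\<gamma>)"
    using b_powr_bounds(2)[of n] b_pos[of n] \<gamma>_pos by (intro powr_mono2') auto
  hence "(2 * (real n + 1)) powr (-1/\<gamma>) \<le> b n"
    using b_eq[of n] by simp
  moreover have "(2 * (real n + 1)) powr (-1/\<gamma>) = 2 powr (-1/\<gamma>) * (real n + 1) powr (-1/\<gamma>)"
    by (rule powr_mult)
  ultimately show ?thesis by (simp only:)
qed

section \<open>A cone of densities preserved by each branch\<close>

text \<open>
  The measure with density \<open>g\<close> on \<open>(0,1)\<close>. Values of \<open>g\<close> outside \<open>(0,1)\<close> are ignored: the cone
  prescribes nothing there, and \<open>x\<^sup>-\<^sup>\<alpha>\<close> is singular at \<open>0\<close>.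
\<close>

definition mass :: "(real \<Rightarrow> real) \<Rightarrow> real set \<Rightarrow> ennreal" where
  "mass g A = (\<integral>\<^sup>+ x. ennreal (g x) * indicator (A \<inter> {0<..<1}) x \<partial>lborel)"

definition lsv_cone :: "(real \<Rightarrow> real) \<Rightarrow> bool" where
  "lsv_cone g \<longleftrightarrow> (\<forall>x\<in>{0<..<1}. 0 \<le> g x) \<and>
     (\<forall>x y. 0 < x \<longrightarrow> x \<le> y \<longrightarrow> y < 1 \<longrightarrow>
        g y \<le> g x \<and> x powr (\<gamma> + 1) * g x \<le> y powr (\<gamma> + 1) * g y)"

text \<open>
  \<open>PL\<close> and \<open>PR\<close> are the contributions of the left and the right branch to the transfer operator
  of \<open>T\<close>; see \<open>mass_PL\<close> and \<open>mass_PR\<close> below.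
\<close>

definition PL :: "(real \<Rightarrow> real) \<Rightarrow> real \<Rightarrow> real" where
  "PL g x = g (\<psi> x) / TL' (\<psi> x)"

definition PR :: "(real \<Rightarrow> real) \<Rightarrow> real \<Rightarrow> real" where
  "PR g x = g ((1 + x) / 2) / 2"

definition K :: real where
  "K = 2 powr (\<gamma> + 1)"

definition balanced :: "(real \<Rightarrow> real) \<Rightarrow> bool" where
  "balanced g \<longleftrightarrow> lsv_cone g \<and> (\<forall>x\<in>{0<..<1}. \<forall>y\<in>{0<..<1}. g x \<le> K * g y)"

lemma coneI:
  assumes "\<And>x. 0 < x \<Longrightarrow> x < 1 \<Longrightarrow> 0 \<le> g x"
    and "\<And>x y. 0 < x \<Longrightarrow> x \<le> y \<Longrightarrow> y < 1 \<Longrightarrow> g y \<le> g x"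
    and "\<And>x y. 0 < x \<Longrightarrow> x \<le> y \<Longrightarrow> y < 1 \<Longrightarrow>
           x powr (\<gamma> + 1) * g x \<le> y powr (\<gamma> + 1) * g y"
  shows "lsv_cone g"
  using assms by (auto simp: lsv_cone_def)

lemma coneD:
  assumes "lsv_cone g"
  shows cone_nonneg: "0 < x \<Longrightarrow> x < 1 \<Longrightarrow> 0 \<le> g x"
    and cone_antimono: "0 < x \<Longrightarrow> x \<le> y \<Longrightarrow> y < 1 \<Longrightarrow> g y \<le> g x"
    and cone_mono: "0 < x \<Longrightarrow> x \<le> y \<Longrightarrow> y < 1 \<Longrightarrow>
           x powr (\<gamma> + 1) * g x \<le> y powr (\<gamma> + 1) * g y"
  using assms by (auto simp: lsv_cone_def)

lemma cone_add:
  assumes "lsv_cone g" "lsv_cone h"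
  shows "lsv_cone (\<lambda>x. g x + h x)"
  using coneD[OF assms(1)] coneD[OF assms(2)]
  by (intro coneI) (auto simp: distrib_left intro!: add_mono)

lemma cone_measurable:
  assumes "lsv_cone g"
  shows "(\<lambda>x. g x * indicator {0<..<1} x) \<in> borel_measurable borel"
proof -
  have "mono_on {0<..<1} (\<lambda>x. - g x)"
    using cone_antimono[OF assms] by (intro mono_onI) auto
  hence "(\<lambda>x. - g x) \<in> borel_measurable (restrict_space borel {0<..<1})"
    by (rule borel_measurable_mono_on_fnc)
  hence "(\<lambda>x. - (- g x)) \<in> borel_measurable (restrict_space borel {0<..<1})"
    by (rule borel_measurable_uminus)
  thus ?thesis by (simp add: borel_measurable_restrict_space_iff mult.commute)
qed

lemma mass_alt:
  "mass g A = (\<integral>\<^sup>+ x. ennreal (g x * indicator {0<..<1} x) * indicator A x \<partial>lborel)"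
  unfolding mass_def by (intro nn_integral_cong) (auto split: split_indicator)

lemma mass_mono:
  assumes "A \<inter> {0<..<1} \<subseteq> B"
  shows "mass g A \<le> mass g B"
  unfolding mass_def using assms by (intro nn_integral_mono) (auto split: split_indicator)

lemma mass_mono_fun:
  assumes "\<And>x. 0 < x \<Longrightarrow> x < 1 \<Longrightarrow> g x \<le> h x"
  shows "mass g A \<le> mass h A"
  unfolding mass_def using assms
  by (intro nn_integral_mono) (auto split: split_indicator intro: ennreal_leI)

lemma mass_add:
  assumes "lsv_cone g" "lsv_cone h" and [measurable]: "A \<in> sets borel"
  shows "mass (\<lambda>x. g x + h x) A = mass g A + mass h A"
proof -
  note [measurable] = cone_measurable[OF assms(1)] cone_measurable[OF assms(2)]
  have "mass (\<lambda>x. g x + h x) A =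
     (\<integral>\<^sup>+ x. ennreal (g x * indicator {0<..<1} x) * indicator A x +
            ennreal (h x * indicator {0<..<1} x) * indicator A x \<partial>lborel)"
    unfolding mass_def using cone_nonneg[OF assms(1)] cone_nonneg[OF assms(2)]
    by (intro nn_integral_cong) (auto split: split_indicator simp: ennreal_plus)
  also have "\<dots> = mass g A + mass h A"
    unfolding mass_alt by (intro nn_integral_add) measurable
  finally show ?thesis .
qed

lemma mass_Un:
  assumes "lsv_cone g" and [measurable]: "A \<in> sets borel" "B \<in> sets borel" and "A \<inter> B = {}"
  shows "mass g (A \<union> B) = mass g A + mass g B"
proof -
  note [measurable] = cone_measurable[OF assms(1)]
  have "mass g (A \<union> B) =
     (\<integral>\<^sup>+ x. ennreal (g x * indicator {0<..<1} x) * indicator A x +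
            ennreal (g x * indicator {0<..<1} x) * indicator B x \<partial>lborel)"
    unfolding mass_def using assms(4)
    by (intro nn_integral_cong) (auto split: split_indicator)
  also have "\<dots> = mass g A + mass g B"
    unfolding mass_alt by (intro nn_integral_add) measurable
  finally show ?thesis .
qed

text \<open>
  This ratio with \<open>s = (2 u)\<^sup>\<gamma>\<close> is the factor by which \<open>PL\<close> changes the weighted density
  \<open>x\<^sup>\<gamma>\<^sup>+\<^sup>1 g(x)\<close> when it is moved from \<open>u\<close> to \<open>x = TL \<gamma> u\<close>. The exponent \<open>\<gamma> + 1\<close> in the cone equals the
  coefficient in the derivative of the branch, which makes the derivative of the ratio have the sign
  of \<open>\<gamma> s\<close>.
\<close>

lemma ratio_mono:
  fixes s t :: real
  assumes "0 \<le> s" "s \<le> t"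
  shows "(1 + s) powr (\<gamma> + 1) / (1 + (\<gamma> + 1) * s) \<le> (1 + t) powr (\<gamma> + 1) / (1 + (\<gamma> + 1) * t)"
proof (rule DERIV_nonneg_imp_nondecreasing[OF assms(2)])
  fix x assume "s \<le> x" "x \<le> t"
  hence x: "0 \<le> x" using assms by simp
  have pos: "0 < 1 + (\<gamma> + 1) * x" using x \<gamma>_pos by (intro add_pos_nonneg) auto
  let ?d = "(\<gamma> + 1) * (1 + x) powr \<gamma> * (\<gamma> * x) / (1 + (\<gamma> + 1) * x)\<^sup>2"
  have "((\<lambda>x. (1 + x) powr (\<gamma> + 1) / (1 + (\<gamma> + 1) * x)) has_real_derivative
      ((\<gamma> + 1) * (1 + x) powr \<gamma> * (1 + (\<gamma> + 1) * x) - (1 + x) powr (\<gamma> + 1) * (\<gamma> + 1))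
        / ((1 + (\<gamma> + 1) * x) * (1 + (\<gamma> + 1) * x))) (at x)"
    using x pos by (auto intro!: derivative_eq_intros)
  also have "(1 + x) powr (\<gamma> + 1) = (1 + x) powr \<gamma> * (1 + x)"
    using x by (simp add: powr_add)
  also have "((\<gamma> + 1) * (1 + x) powr \<gamma> * (1 + (\<gamma> + 1) * x) - (1 + x) powr \<gamma> * (1 + x) * (\<gamma> + 1))
        / ((1 + (\<gamma> + 1) * x) * (1 + (\<gamma> + 1) * x)) = ?d"
    by (simp add: power2_eq_square algebra_simps)
  finally have "((\<lambda>x. (1 + x) powr (\<gamma> + 1) / (1 + (\<gamma> + 1) * x)) has_real_derivative ?d) (at x)" .
  moreover have "0 \<le> ?d" using x \<gamma>_pos by (intro divide_nonneg_nonneg mult_nonneg_nonneg) auto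
  ultimately show "\<exists>d. ((\<lambda>x. (1 + x) powr (\<gamma> + 1) / (1 + (\<gamma> + 1) * x)) has_real_derivative d) (at x) \<and> 0 \<le> d"
    by blast
qed

text \<open>
  The branch is convex, so dividing by its derivative keeps a decreasing density decreasing; the
  weighted density is multiplied by the increasing factor of \<open>ratio_mono\<close>.
\<close>

lemma cone_PL:
  assumes "lsv_cone g"
  shows "lsv_cone (PL g)"
proof (rule coneI)
  fix x :: real assume x: "0 < x" "x < 1"
  thus "0 \<le> PL g x" using \<psi>_bounds[of x] TL'_ge_1[of "\<psi> x"]
    by (auto simp: PL_def intro!: divide_nonneg_nonneg cone_nonneg[OF assms])
next
  fix x y :: real assume xy: "0 < x" "x \<le> y" "y < 1"
  define u where "u = \<psi> x"
  define v where "v = \<psi> y"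
  have uv: "0 < u" "u \<le> v" "v < 1/2"
    using \<psi>_bounds[of x] \<psi>_bounds[of y] \<psi>_le_iff[of x y] xy by (auto simp: u_def v_def)
  have TL_uv: "TL \<gamma> u = x" "TL \<gamma> v = y"
    using xy by (auto simp: u_def v_def TL_\<psi>)
  have nonneg: "0 \<le> g u" "0 \<le> g v" using uv by (auto intro!: cone_nonneg[OF assms])
  show "PL g y \<le> PL g x"
    unfolding PL_def u_def[symmetric] v_def[symmetric]
    using uv nonneg TL'_ge_1[of u] by (intro frac_le TL'_mono cone_antimono[OF assms]) auto
  have weight: "TL \<gamma> w powr (\<gamma> + 1) * (g w / TL' w) =
      w powr (\<gamma> + 1) * g w *
        ((1 + (2 * w) powr \<gamma>) powr (\<gamma> + 1) / (1 + (\<gamma> + 1) * (2 * w) powr \<gamma>))"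
    if "0 < w" for w
    using that by (simp add: TL_factor TL'_alt powr_mult)
  have "(2 * u) powr \<gamma> \<le> (2 * v) powr \<gamma>"
    using uv \<gamma>_pos by (intro powr_mono2) auto
  hence "u powr (\<gamma> + 1) * g u *
        ((1 + (2 * u) powr \<gamma>) powr (\<gamma> + 1) / (1 + (\<gamma> + 1) * (2 * u) powr \<gamma>))
      \<le> v powr (\<gamma> + 1) * g v *
        ((1 + (2 * v) powr \<gamma>) powr (\<gamma> + 1) / (1 + (\<gamma> + 1) * (2 * v) powr \<gamma>))"
    using uv nonneg \<gamma>_pos
    by (intro mult_mono ratio_mono cone_mono[OF assms] mult_nonneg_nonneg divide_nonneg_nonneg) auto
  thus "x powr (\<gamma> + 1) * PL g x \<le> y powr (\<gamma> + 1) * PL g y"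
    unfolding PL_def u_def[symmetric] v_def[symmetric]
    using weight[of u] weight[of v] TL_uv uv by simp
qed

text \<open>The weighted density is multiplied by an increasing factor, the power of \<open>2 x / (1 + x)\<close>.\<close>

lemma cone_PR:
  assumes "lsv_cone g"
  shows "lsv_cone (PR g)"
proof (rule coneI)
  fix x :: real assume x: "0 < x" "x < 1"
  thus "0 \<le> PR g x" by (auto simp: PR_def intro!: cone_nonneg[OF assms])
next
  fix x y :: real assume xy: "0 < x" "x \<le> y" "y < 1"
  define u where "u = (1 + x) / 2"
  define v where "v = (1 + y) / 2"
  have uv: "0 < u" "u \<le> v" "v < 1" using xy by (auto simp: u_def v_def)
  have nonneg: "0 \<le> g u" "0 \<le> g v" using uv by (auto intro!: cone_nonneg[OF assms])
  show "PR g y \<le> PR g x"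
    unfolding PR_def u_def[symmetric] v_def[symmetric]
    using cone_antimono[OF assms uv] by simp
  have "x / u \<le> y / v" using xy by (simp add: u_def v_def field_simps)
  hence "(x / u) powr (\<gamma> + 1) \<le> (y / v) powr (\<gamma> + 1)"
    using xy uv \<gamma>_pos by (intro powr_mono2) auto
  hence "(x / u) powr (\<gamma> + 1) * (u powr (\<gamma> + 1) * g u) \<le> (y / v) powr (\<gamma> + 1) * (v powr (\<gamma> + 1) * g v)"
    using nonneg by (intro mult_mono cone_mono[OF assms uv]) auto
  moreover have "(z / w) powr (\<gamma> + 1) * (w powr (\<gamma> + 1) * g w) = z powr (\<gamma> + 1) * g w"
    if "0 < w" "0 < z" for z w using that by (simp add: powr_divide)
  ultimately have "x powr (\<gamma> + 1) * g u \<le> y powr (\<gamma> + 1) * g v"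
    using xy uv by simp
  thus "x powr (\<gamma> + 1) * PR g x \<le> y powr (\<gamma> + 1) * PR g y"
    unfolding PR_def u_def[symmetric] v_def[symmetric] by simp
qed

lemma K_ge_1: "1 \<le> K"
  unfolding K_def using \<gamma>_pos by (intro ge_one_powr_ge_zero) auto

text \<open>
  The values of \<open>PR g\<close> come from \<open>[1/2, 1]\<close>, on which the weight \<open>x\<^sup>\<gamma>\<^sup>+\<^sup>1\<close> varies by the factor \<open>K\<close> only.
\<close>

lemma balanced_PR:
  assumes "lsv_cone g"
  shows "balanced (PR g)"
  unfolding balanced_def
proof (intro conjI ballI cone_PR assms)
  fix x y :: real assume "x \<in> {0<..<1}" "y \<in> {0<..<1}"
  hence xy: "0 < x" "x < 1" "0 < y" "y < 1" by auto
  define u where "u = (1 + x) / 2"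
  define v where "v = (1 + y) / 2"
  have uv: "1/2 < u" "u < 1" "1/2 < v" "v < 1" using xy by (auto simp: u_def v_def)
  have nonneg: "0 \<le> g u" "0 \<le> g v" using uv by (auto intro!: cone_nonneg[OF assms])
  have "g u \<le> K * g v"
  proof (cases "v \<le> u")
    case True
    hence "g u \<le> 1 * g v" using uv by (simp add: cone_antimono[OF assms])
    also have "\<dots> \<le> K * g v" using nonneg K_ge_1 by (intro mult_right_mono) auto
    finally show ?thesis .
  next
    case False
    have "(1/2) powr (\<gamma> + 1) * g u \<le> u powr (\<gamma> + 1) * g u"
      using uv nonneg \<gamma>_pos by (intro mult_right_mono powr_mono2) auto
    also have "\<dots> \<le> v powr (\<gamma> + 1) * g v"
      using uv False by (intro cone_mono[OF assms]) auto
    also have "\<dots> \<le> 1 * g v"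
      using uv nonneg \<gamma>_pos by (intro mult_right_mono powr_le1) auto
    finally show ?thesis by (simp add: K_def powr_divide field_simps)
  qed
  thus "PR g x \<le> K * PR g y"
    unfolding PR_def u_def[symmetric] v_def[symmetric] by simp
qed

lemma mass_PL:
  assumes "lsv_cone g" and [measurable]: "A \<in> sets borel"
  shows "mass g {x. x < 1/2 \<and> T \<gamma> x \<in> A} = mass (PL g) A"
proof -
  note [measurable] = cone_measurable[OF cone_PL[OF assms(1)]]
  define f where "f = (\<lambda>x. PL g x * indicator {0<..<1} x * indicator A x)"
  have [measurable]: "f \<in> borel_measurable borel" unfolding f_def by measurable
  have "mass (PL g) A = (\<integral>\<^sup>+ x. f x * indicator {TL \<gamma> 0..TL \<gamma> (1/2)} x \<partial>lborel)"
    unfolding mass_def f_def by (intro nn_integral_cong) (auto split: split_indicator)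
  also have "\<dots> = (\<integral>\<^sup>+ x. f (TL \<gamma> x) * TL' x * indicator {0..1/2} x \<partial>lborel)"
  proof (rule nn_integral_substitution)
    show "set_borel_measurable borel {TL \<gamma> 0..TL \<gamma> (1/2)} f"
      unfolding set_borel_measurable_def by measurable
    show "0 \<le> TL' x" for x using TL'_ge_1[of x] by simp
  qed (auto intro: TL_has_derivative continuous_on_TL')
  also have "\<dots> = mass g {x. x < 1/2 \<and> T \<gamma> x \<in> A}"
    unfolding mass_def
  proof (rule nn_integral_cong)
    fix x :: real
    show "ennreal (f (TL \<gamma> x) * TL' x * indicator {0..1/2} x) =
      ennreal (g x) * indicator ({x. x < 1/2 \<and> T \<gamma> x \<in> A} \<inter> {0<..<1}) x"
    proof (cases "0 < x \<and> x < 1/2")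
      case True
      hence "0 < TL \<gamma> x" "TL \<gamma> x < 1"
        using TL_strict_mono[of 0 x] TL_strict_mono[of x "1/2"] by auto
      moreover have "PL g (TL \<gamma> x) * TL' x = g x"
        using True TL'_ge_1[of x] by (simp add: PL_def \<psi>_TL)
      ultimately show ?thesis using True
        by (auto simp: f_def T_left split: split_indicator)
    next
      case False
      then consider "x = 0" | "x = 1/2" | "x \<notin> {0..1/2}" by fastforce
      thus ?thesis
      proof cases
        assume x: "x = 1/2"
        show ?thesis unfolding x TL_half f_def by simp
      qed (auto simp: f_def)
    qed
  qed
  finally show ?thesis ..
qed

lemma mass_PR:
  assumes "lsv_cone g" and [measurable]: "A \<in> sets borel"
  shows "mass g {x. 1/2 \<le> x \<and> T \<gamma> x \<in> A} = mass (PR g) A"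
proof -
  note [measurable] = cone_measurable[OF cone_PR[OF assms(1)]]
  define f where "f = (\<lambda>x. PR g x * indicator {0<..<1} x * indicator A x)"
  have [measurable]: "f \<in> borel_measurable borel" unfolding f_def by measurable
  have "mass (PR g) A = (\<integral>\<^sup>+ x. f x * indicator {2 * (1/2) - 1..2 * 1 - 1} x \<partial>lborel)"
    unfolding mass_def f_def by (intro nn_integral_cong) (auto split: split_indicator)
  also have "\<dots> = (\<integral>\<^sup>+ x. f (2 * x - 1) * 2 * indicator {1/2..1} x \<partial>lborel)"
  proof (rule nn_integral_substitution)
    show "set_borel_measurable borel {2 * (1/2) - 1..2 * 1 - 1} f"
      unfolding set_borel_measurable_def by measurable
  qed (auto intro!: derivative_eq_intros)
  also have "\<dots> = mass g {x. 1/2 \<le> x \<and> T \<gamma> x \<in> A}"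
    unfolding mass_def
  proof (rule nn_integral_cong_AE)
    have "ennreal (f (2 * x - 1) * 2 * indicator {1/2..1} x) =
      ennreal (g x) * indicator ({x. 1/2 \<le> x \<and> T \<gamma> x \<in> A} \<inter> {0<..<1}) x" if "x \<noteq> 1/2" for x
      using that by (auto simp: f_def T_right PR_def split: split_indicator)
    thus "AE x in lborel. ennreal (f (2 * x - 1) * 2 * indicator {1/2..1} x) =
      ennreal (g x) * indicator ({x. 1/2 \<le> x \<and> T \<gamma> x \<in> A} \<inter> {0<..<1}) x"
      using AE_lborel_singleton[of "1/2"] by (auto elim!: eventually_mono)
  qed
  finally show ?thesis ..
qed

lemma mass_preimage:
  assumes "lsv_cone g" and [measurable]: "A \<in> sets borel"
  shows "mass g {x. T \<gamma> x \<in> A} = mass (PL g) A + mass (PR g) A"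
proof -
  have "mass g ({x. x < 1/2 \<and> T \<gamma> x \<in> A} \<union> {x. 1/2 \<le> x \<and> T \<gamma> x \<in> A}) =
      mass (PL g) A + mass (PR g) A"
    unfolding mass_PL[OF assms, symmetric] mass_PR[OF assms, symmetric]
    by (rule mass_Un[OF assms(1)]) auto
  also have "{x. x < 1/2 \<and> T \<gamma> x \<in> A} \<union> {x. 1/2 \<le> x \<and> T \<gamma> x \<in> A} = {x. T \<gamma> x \<in> A}"
    by auto
  finally show ?thesis .
qed

lemma mass_const:
  assumes [measurable]: "A \<in> sets borel"
  shows "mass (\<lambda>_. c) A = ennreal c * emeasure lborel (A \<inter> {0<..<1})"
  unfolding mass_def by (rule nn_integral_cmult_indicator) auto

lemma mass_cmult:
  assumes "lsv_cone g" "0 \<le> c" and [measurable]: "A \<in> sets borel"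
  shows "mass (\<lambda>x. c * g x) A = ennreal c * mass g A"
proof -
  note [measurable] = cone_measurable[OF assms(1)]
  have "mass (\<lambda>x. c * g x) A =
     (\<integral>\<^sup>+ x. ennreal c * (ennreal (g x * indicator {0<..<1} x) * indicator A x) \<partial>lborel)"
    unfolding mass_def using assms(2) cone_nonneg[OF assms(1)]
    by (intro nn_integral_cong) (auto split: split_indicator simp: ennreal_mult)
  also have "\<dots> = ennreal c * mass g A"
    unfolding mass_alt by (intro nn_integral_cmult) measurable
  finally show ?thesis .
qed

text \<open>
  The mean of a balanced density over \<open>(0,1)\<close> is its total mass \<open>G\<close>, and every value is within the
  factor \<open>K\<close> of the mean.
\<close>

lemma balanced_bounds:
  assumes "balanced g"
  shows "\<exists>G\<ge>0. mass g UNIV = ennreal G \<and> (\<forall>x\<in>{0<..<1}. G \<le> K * g x \<and> g x \<le> K * G)"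
proof -
  have g: "lsv_cone g" and bal: "\<And>x y. 0 < x \<Longrightarrow> x < 1 \<Longrightarrow> 0 < y \<Longrightarrow> y < 1 \<Longrightarrow> g x \<le> K * g y"
    using assms by (auto simp: balanced_def)
  have upper: "mass g UNIV \<le> ennreal (K * g x)" if "0 < x" "x < 1" for x
  proof -
    have "mass g UNIV \<le> mass (\<lambda>_. K * g x) UNIV"
      using that by (intro mass_mono_fun bal)
    thus ?thesis by (simp add: mass_const)
  qed
  have lower: "ennreal (g x / K) \<le> mass g UNIV" if "0 < x" "x < 1" for x
  proof -
    have "mass (\<lambda>_. g x / K) UNIV \<le> mass g UNIV"
      using that bal K_ge_1 by (intro mass_mono_fun) (auto simp: divide_le_eq mult.commute)
    thus ?thesis by (simp add: mass_const)
  qed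
  define G where "G = enn2real (mass g UNIV)"
  have "mass g UNIV < \<infinity>"
    using upper[of "1/2"] by (auto intro: le_less_trans)
  hence G: "mass g UNIV = ennreal G" by (simp add: G_def)
  have G0: "0 \<le> G" by (simp add: G_def)
  have "G \<le> K * g x \<and> g x \<le> K * G" if x: "0 < x" "x < 1" for x
  proof
    show "G \<le> K * g x"
      using upper[OF x] K_ge_1 cone_nonneg[OF g x] unfolding G by (subst (asm) ennreal_le_iff) auto
    have "g x / K \<le> G" using lower[OF x] G0 unfolding G by (simp add: ennreal_le_iff)
    thus "g x \<le> K * G" using K_ge_1 by (simp add: divide_le_eq mult.commute)
  qed
  with G0 G show ?thesis by (intro exI[of _ G]) auto
qed

section \<open>Sets determined by finitely many symbols\<close>

text \<open>
  Both branches of \<open>T\<close> are onto, so such a set pulls back along either branch to one that is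
  determined by one symbol fewer. All facts below follow by induction along this.
\<close>

definition determined :: "nat \<Rightarrow> real set \<Rightarrow> bool" where
  "determined N H \<longleftrightarrow> H \<subseteq> II \<and>
     (\<forall>x\<in>II. \<forall>y\<in>II. (\<forall>i<N. (T \<gamma> ^^ i) x < 1/2 \<longleftrightarrow> (T \<gamma> ^^ i) y < 1/2) \<longrightarrow> (x \<in> H \<longleftrightarrow> y \<in> H))"

lemma determined_0:
  assumes "determined 0 H"
  shows "H = {} \<or> H = II"
  using assms by (auto simp: determined_def)

lemma determined_Suc_left:
  assumes "determined (Suc N) H"
  shows "determined N {y \<in> II. \<psi> y \<in> H}"
  unfolding determined_def
proof (intro conjI ballI impI)
  fix x y assume xy: "x \<in> II" "y \<in> II" and
    sym: "\<forall>i<N. (T \<gamma> ^^ i) x < 1/2 \<longleftrightarrow> (T \<gamma> ^^ i) y < 1/2"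
  have "(T \<gamma> ^^ i) (\<psi> x) < 1/2 \<longleftrightarrow> (T \<gamma> ^^ i) (\<psi> y) < 1/2" if "i < Suc N" for i
  proof (cases i)
    case 0
    thus ?thesis using T_\<psi>(2)[OF xy(1)] T_\<psi>(2)[OF xy(2)] by simp
  next
    case (Suc j)
    have "(T \<gamma> ^^ i) (\<psi> z) = (T \<gamma> ^^ j) z" if "z \<in> II" for z
      unfolding Suc funpow_Suc_right o_def T_\<psi>(3)[OF that] ..
    thus ?thesis using sym xy Suc that by simp
  qed
  hence "\<psi> x \<in> H \<longleftrightarrow> \<psi> y \<in> H"
    using assms xy T_\<psi>(1) unfolding determined_def by blast
  thus "x \<in> {y \<in> II. \<psi> y \<in> H} \<longleftrightarrow> y \<in> {y \<in> II. \<psi> y \<in> H}" using xy by simp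
qed auto

lemma T_right_inverse:
  assumes "x \<in> II"
  shows "(1 + x) / 2 \<in> II" "\<not> (1 + x) / 2 < 1/2" "T \<gamma> ((1 + x) / 2) = x"
  using assms by (auto simp: II_def T_right field_simps)

lemma determined_Suc_right:
  assumes "determined (Suc N) H"
  shows "determined N {y \<in> II. (1 + y) / 2 \<in> H}"
  unfolding determined_def
proof (intro conjI ballI impI)
  fix x y assume xy: "x \<in> II" "y \<in> II" and
    sym: "\<forall>i<N. (T \<gamma> ^^ i) x < 1/2 \<longleftrightarrow> (T \<gamma> ^^ i) y < 1/2"
  have "(T \<gamma> ^^ i) ((1 + x) / 2) < 1/2 \<longleftrightarrow> (T \<gamma> ^^ i) ((1 + y) / 2) < 1/2" if "i < Suc N" for i
  proof (cases i)
    case 0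
    thus ?thesis using T_right_inverse(2)[OF xy(1)] T_right_inverse(2)[OF xy(2)] by simp
  next
    case (Suc j)
    have "(T \<gamma> ^^ i) ((1 + z) / 2) = (T \<gamma> ^^ j) z" if "z \<in> II" for z
      unfolding Suc funpow_Suc_right o_def T_right_inverse(3)[OF that] ..
    thus ?thesis using sym xy Suc that by simp
  qed
  hence "(1 + x) / 2 \<in> H \<longleftrightarrow> (1 + y) / 2 \<in> H"
    using assms xy T_right_inverse(1) unfolding determined_def by blast
  thus "x \<in> {y \<in> II. (1 + y) / 2 \<in> H} \<longleftrightarrow> y \<in> {y \<in> II. (1 + y) / 2 \<in> H}" using xy by simp
qed auto

lemma mem_via_left:
  assumes "x \<in> II" "x < 1/2"
  shows "x \<in> H \<longleftrightarrow> T \<gamma> x \<in> {y \<in> II. \<psi> y \<in> H}"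
  using assms \<psi>_TL[of x] T_II[of x] by (auto simp: T_left II_def)

lemma mem_via_right:
  assumes "x \<in> II" "1/2 \<le> x"
  shows "x \<in> H \<longleftrightarrow> T \<gamma> x \<in> {y \<in> II. (1 + y) / 2 \<in> H}"
  using assms T_II[of x] by (auto simp: T_right)

lemma II_borel [measurable]: "II \<in> sets borel"
  by (simp add: II_def)

lemma determined_borel: "determined N H \<Longrightarrow> H \<in> sets borel"
proof (induction N arbitrary: H)
  case 0
  thus ?case using determined_0[of H] by auto
next
  case (Suc N)
  define H1 where "H1 = {y \<in> II. \<psi> y \<in> H}"
  define H2 where "H2 = {y \<in> II. (1 + y) / 2 \<in> H}"
  have [measurable]: "H1 \<in> sets borel" "H2 \<in> sets borel"
    using Suc.IH[OF determined_Suc_left[OF Suc.prems]] Suc.IH[OF determined_Suc_right[OF Suc.prems]]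
    by (simp_all add: H1_def H2_def)
  have "H \<subseteq> II" using Suc.prems by (simp add: determined_def)
  hence "x \<in> H \<longleftrightarrow> x \<in> II \<and> (x < 1/2 \<and> T \<gamma> x \<in> H1 \<or> 1/2 \<le> x \<and> T \<gamma> x \<in> H2)" for x
    using mem_via_left[of x H] mem_via_right[of x H]
    unfolding H1_def[symmetric] H2_def[symmetric] by (cases "x < 1/2") auto
  hence "H = (II \<inter> {x. x < 1/2 \<and> T \<gamma> x \<in> H1}) \<union> (II \<inter> {x. 1/2 \<le> x \<and> T \<gamma> x \<in> H2})" (is "_ = ?R")
    by blast
  also have "?R \<in> sets borel" by measurable
  finally show ?case .
qed

text \<open>
  The measure that \<open>T\<^sup>N\<close> transports from the complement of \<open>H\<close> is the sum of the contributions of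
  those compositions of \<open>N\<close> branches whose cylinders do not lie in \<open>H\<close>. Each contribution is in the
  cone, so removing the hole does not spoil the regularity of the density. There are at most \<open>2\<^sup>N\<close>
  contributions, and none exceeds the bound for \<open>g\<close>.
\<close>

lemma restricted_pushforward:
  assumes "determined N H" "lsv_cone g" "\<And>x. 0 < x \<Longrightarrow> x < 1 \<Longrightarrow> g x \<le> M"
  shows "\<exists>h. lsv_cone h \<and> (\<forall>x\<in>{0<..<1}. h x \<le> 2 ^ N * M) \<and>
    (\<forall>A\<in>sets borel. mass h A = mass g {x \<in> II. x \<notin> H \<and> (T \<gamma> ^^ N) x \<in> A})"
  using assms
proof (induction N arbitrary: g H)
  case 0
  have M: "0 \<le> M" using 0(3)[of "1/2"] cone_nonneg[OF 0(2), of "1/2"] by auto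
  from determined_0[OF 0(1)] show ?case
  proof
    assume "H = {}"
    moreover have "mass g A = mass g {x \<in> II. x \<in> A}" for A
      unfolding mass_def by (intro nn_integral_cong) (auto simp: II_def split: split_indicator)
    ultimately show ?thesis using 0 by (intro exI[of _ g]) auto
  next
    assume "H = II"
    thus ?thesis using M by (intro exI[of _ "\<lambda>_. 0"]) (auto intro: coneI simp: mass_def)
  qed
next
  case (Suc N)
  define H1 where "H1 = {y \<in> II. \<psi> y \<in> H}"
  define H2 where "H2 = {y \<in> II. (1 + y) / 2 \<in> H}"
  have det: "determined N H1" "determined N H2"
    using determined_Suc_left[OF Suc.prems(1)] determined_Suc_right[OF Suc.prems(1)]
    by (auto simp: H1_def H2_def)
  note [measurable] = determined_borel[OF det(1)] determined_borel[OF det(2)]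
  have g: "lsv_cone g" by fact
  have PL_le: "PL g x \<le> M" if "0 < x" "x < 1" for x
  proof -
    have "g (\<psi> x) / TL' (\<psi> x) \<le> g (\<psi> x) / 1"
      using \<psi>_bounds[of x] that TL'_ge_1[of "\<psi> x"] by (intro divide_left_mono cone_nonneg[OF g]) auto
    also have "\<dots> \<le> M" using Suc.prems(3)[of "\<psi> x"] \<psi>_bounds[of x] that by simp
    finally show ?thesis by (simp add: PL_def)
  qed
  have PR_le: "PR g x \<le> M" if "0 < x" "x < 1" for x
    using Suc.prems(3)[of "(1 + x) / 2"] cone_nonneg[OF g, of "(1 + x) / 2"] that
    by (simp add: PR_def)
  obtain h1 where h1: "lsv_cone h1" "\<forall>x\<in>{0<..<1}. h1 x \<le> 2 ^ N * M"
    "\<And>A. A \<in> sets borel \<Longrightarrow> mass h1 A = mass (PL g) {x \<in> II. x \<notin> H1 \<and> (T \<gamma> ^^ N) x \<in> A}"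
    using Suc.IH[OF det(1) cone_PL[OF g] PL_le] by blast
  obtain h2 where h2: "lsv_cone h2" "\<forall>x\<in>{0<..<1}. h2 x \<le> 2 ^ N * M"
    "\<And>A. A \<in> sets borel \<Longrightarrow> mass h2 A = mass (PR g) {x \<in> II. x \<notin> H2 \<and> (T \<gamma> ^^ N) x \<in> A}"
    using Suc.IH[OF det(2) cone_PR[OF g] PR_le] by blast
  have "mass (\<lambda>x. h1 x + h2 x) A = mass g {x \<in> II. x \<notin> H \<and> (T \<gamma> ^^ Suc N) x \<in> A}"
    if [measurable]: "A \<in> sets borel" for A
  proof -
    define B1 where "B1 = {x \<in> II. x \<notin> H1 \<and> (T \<gamma> ^^ N) x \<in> A}"
    define B2 where "B2 = {x \<in> II. x \<notin> H2 \<and> (T \<gamma> ^^ N) x \<in> A}"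
    have B_borel [measurable]: "B1 \<in> sets borel" "B2 \<in> sets borel"
      unfolding B1_def B2_def by measurable
    have "mass (\<lambda>x. h1 x + h2 x) A = mass (PL g) B1 + mass (PR g) B2"
      using h1 h2 that by (simp add: mass_add B1_def B2_def)
    also have "\<dots> = mass g ({x. x < 1/2 \<and> T \<gamma> x \<in> B1} \<union> {x. 1/2 \<le> x \<and> T \<gamma> x \<in> B2})"
      unfolding mass_PL[OF g B_borel(1), symmetric] mass_PR[OF g B_borel(2), symmetric]
      by (rule mass_Un[OF g, symmetric]) auto
    also have "\<dots> = mass g {x \<in> II. x \<notin> H \<and> (T \<gamma> ^^ Suc N) x \<in> A}"
    proof (rule antisym; rule mass_mono)
      have iff: "x < 1/2 \<and> T \<gamma> x \<in> B1 \<or> 1/2 \<le> x \<and> T \<gamma> x \<in> B2 \<longleftrightarrow> x \<notin> H \<and> (T \<gamma> ^^ Suc N) x \<in> A"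
        if "x \<in> II" for x
        using mem_via_left[OF that, of H] mem_via_right[OF that, of H] T_II[OF that]
        unfolding funpow_Suc_right o_def B1_def B2_def H1_def[symmetric] H2_def[symmetric]
        by (cases "x < 1/2") auto
      have sub: "{0<..<1} \<subseteq> II" by (auto simp: II_def)
      show "({x. x < 1/2 \<and> T \<gamma> x \<in> B1} \<union> {x. 1/2 \<le> x \<and> T \<gamma> x \<in> B2}) \<inter> {0<..<1}
        \<subseteq> {x \<in> II. x \<notin> H \<and> (T \<gamma> ^^ Suc N) x \<in> A}" using iff sub by blast
      show "{x \<in> II. x \<notin> H \<and> (T \<gamma> ^^ Suc N) x \<in> A} \<inter> {0<..<1}
        \<subseteq> {x. x < 1/2 \<and> T \<gamma> x \<in> B1} \<union> {x. 1/2 \<le> x \<and> T \<gamma> x \<in> B2}" using iff by blast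
    qed
    finally show ?thesis .
  qed
  moreover have "h1 x + h2 x \<le> 2 ^ Suc N * M" if "x \<in> {0<..<1}" for x
    using h1(2) h2(2) that by fastforce
  ultimately show ?case using cone_add[OF h1(1) h2(1)] by blast
qed

text \<open>The derivative of \<open>T\<close> is at most \<open>3\<close>, so a pullback shrinks lengths by a bounded factor.\<close>

lemma determined_pos:
  assumes "determined N H" "H \<noteq> {}"
  shows "\<exists>\<delta>>0. ennreal \<delta> \<le> mass (\<lambda>_. 1) H"
  using assms
proof (induction N arbitrary: H)
  case 0
  hence "H = II" using determined_0 by blast
  moreover have "mass (\<lambda>_. 1) II = 1"
    by (subst mass_const) (auto simp: II_def Int_absorb1 greaterThanLessThan_subseteq_atLeastLessThan_iff)
  ultimately show ?case by (intro exI[of _ 1]) auto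
next
  case (Suc N)
  have one: "lsv_cone (\<lambda>_. 1)"
  proof (rule coneI)
    show "x powr (\<gamma> + 1) * 1 \<le> y powr (\<gamma> + 1) * 1" if "0 < x" "x \<le> y" for x y :: real
      using that \<gamma>_pos by (intro mult_right_mono powr_mono2) auto
  qed auto
  have "H \<subseteq> II" using Suc.prems(1) unfolding determined_def by (rule conjunct1)
  with Suc.prems(2) obtain x where x: "x \<in> H" "x \<in> II" by blast
  show ?case
  proof (cases "x < 1/2")
    case True
    define H1 where "H1 = {y \<in> II. \<psi> y \<in> H}"
    have det: "determined N H1" unfolding H1_def by (rule determined_Suc_left[OF Suc.prems(1)])
    note [measurable] = determined_borel[OF det]
    have "H1 \<noteq> {}" using mem_via_left[OF x(2) True, of H, folded H1_def] x(1) by blast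
    then obtain \<delta> where \<delta>: "\<delta> > 0" "ennreal \<delta> \<le> mass (\<lambda>_. 1) H1" using Suc.IH[OF det] by blast
    have "ennreal (\<delta> / 3) = ennreal (1/3) * ennreal \<delta>"
      using \<delta>(1) by (simp add: ennreal_mult[symmetric])
    also have "\<dots> \<le> ennreal (1/3) * mass (\<lambda>_. 1) H1"
      using \<delta>(2) by (rule mult_left_mono) auto
    also have "\<dots> = mass (\<lambda>_. 1/3) H1"
      by (simp add: mass_const)
    also have "\<dots> \<le> mass (PL (\<lambda>_. 1)) H1"
    proof (rule mass_mono_fun)
      fix y :: real assume "0 < y" "y < 1"
      thus "1/3 \<le> PL (\<lambda>_. 1) y" using \<psi>_bounds[of y] TL'_le_3[of "\<psi> y"] TL'_ge_1[of "\<psi> y"]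
        by (auto simp: PL_def field_simps)
    qed
    also have "\<dots> = mass (\<lambda>_. 1) {x. x < 1/2 \<and> T \<gamma> x \<in> H1}"
      by (rule mass_PL[OF one, symmetric]) auto
    also have "\<dots> \<le> mass (\<lambda>_. 1) H"
      using mem_via_left[of _ H, folded H1_def] by (intro mass_mono) (auto simp: II_def)
    finally show ?thesis using \<delta>(1) by (intro exI[of _ "\<delta> / 3"]) simp
  next
    case False
    define H2 where "H2 = {y \<in> II. (1 + y) / 2 \<in> H}"
    have det: "determined N H2" unfolding H2_def by (rule determined_Suc_right[OF Suc.prems(1)])
    note [measurable] = determined_borel[OF det]
    have "H2 \<noteq> {}" using mem_via_right[OF x(2), of H, folded H2_def] False x(1) by fastforce
    then obtain \<delta> where \<delta>: "\<delta> > 0" "ennreal \<delta> \<le> mass (\<lambda>_. 1) H2" using Suc.IH[OF det] by blast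
    have "ennreal (\<delta> / 2) = ennreal (1/2) * ennreal \<delta>"
      using \<delta>(1) by (subst ennreal_mult[symmetric]) auto
    also have "\<dots> \<le> ennreal (1/2) * mass (\<lambda>_. 1) H2"
      using \<delta>(2) by (rule mult_left_mono) auto
    also have "\<dots> = mass (\<lambda>_. 1/2) H2"
      by (simp add: mass_const)
    also have "(\<lambda>_. 1/2) = PR (\<lambda>_. 1)" by (simp add: PR_def fun_eq_iff)
    also have "mass (PR (\<lambda>_. 1)) H2 = mass (\<lambda>_. 1) {x. 1/2 \<le> x \<and> T \<gamma> x \<in> H2}"
      by (rule mass_PR[OF one, symmetric]) auto
    also have "\<dots> \<le> mass (\<lambda>_. 1) H"
      using mem_via_right[of _ H, folded H2_def] by (intro mass_mono) (auto simp: II_def)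
    finally show ?thesis using \<delta>(1) by (intro exI[of _ "\<delta> / 2"]) simp
  qed
qed

text \<open>
  A balanced density is at least its mean over \<open>K\<close>, so the hole receives at least the
  proportion \<open>\<delta> / K\<close>, where \<open>\<delta>\<close> bounds the length of the hole from below.
\<close>

lemma mass_avoiding_le:
  assumes "determined N H" "H \<noteq> {}"
  obtains \<rho> where "0 < \<rho>" "\<rho> < 1"
    "\<And>g G. balanced g \<Longrightarrow> mass g UNIV = ennreal G \<Longrightarrow> 0 \<le> G \<Longrightarrow> mass g (II - H) \<le> ennreal (\<rho> * G)"
proof -
  note [measurable] = determined_borel[OF assms(1)]
  obtain \<delta> where \<delta>: "\<delta> > 0" "ennreal \<delta> \<le> mass (\<lambda>_. 1) H" using determined_pos[OF assms] by blast
  \<comment> \<open>the maximum keeps \<open>\<rho>\<close> positive: \<open>renewal_decay\<close> takes powers of \<open>\<rho>\<close> with negative exponent\<close>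
  define \<rho> where "\<rho> = max (1/2) (1 - \<delta> / K)"
  show ?thesis
  proof
    show "0 < \<rho>" "\<rho> < 1" using \<delta>(1) K_ge_1 by (auto simp: \<rho>_def)
  next
    fix g G assume g: "balanced g" "mass g UNIV = ennreal G" "0 \<le> G"
    hence cone: "lsv_cone g" by (simp add: balanced_def)
    obtain G' where G': "0 \<le> G'" "mass g UNIV = ennreal G'" "\<forall>x\<in>{0<..<1}. G' \<le> K * g x"
      using balanced_bounds[OF g(1)] by blast
    have "G' = G" using G'(1,2) g(2,3) by simp
    have "ennreal (G / K * \<delta>) = ennreal (G / K) * ennreal \<delta>"
      using g \<delta>(1) K_ge_1 by (intro ennreal_mult) auto
    also have "\<dots> \<le> ennreal (G / K) * mass (\<lambda>_. 1) H"
      using \<delta>(2) by (rule mult_left_mono) auto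
    also have "\<dots> = mass (\<lambda>_. G / K) H"
      by (simp add: mass_const)
    also have "\<dots> \<le> mass g H"
      using G'(3) K_ge_1 unfolding \<open>G' = G\<close> by (intro mass_mono_fun) (auto simp: divide_le_eq mult.commute)
    finally have H: "ennreal (G / K * \<delta>) \<le> mass g H" .
    have "mass g (II - H) + mass g H = mass g ((II - H) \<union> H)"
      by (rule mass_Un[OF cone, symmetric]) auto
    also have "\<dots> \<le> ennreal G" unfolding g(2)[symmetric] by (rule mass_mono) auto
    finally have sum: "mass g (II - H) + mass g H \<le> ennreal G" .
    have "mass g (II - H) + ennreal (G / K * \<delta>) \<le> ennreal G"
      using add_left_mono[OF H] sum by (rule order_trans)
    then have "mass g (II - H) \<le> ennreal (G - G / K * \<delta>)"
      using g(3) \<delta>(1) K_ge_1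
      by (cases "mass g (II - H)") (auto simp: ennreal_plus[symmetric] top_unique simp del: ennreal_plus)
    also have "G - G / K * \<delta> = (1 - \<delta> / K) * G" by (simp add: algebra_simps)
    also have "ennreal \<dots> \<le> ennreal (\<rho> * G)"
      using g(3) by (intro ennreal_leI mult_right_mono) (auto simp: \<rho>_def)
    finally show "mass g (II - H) \<le> ennreal (\<rho> * G)" .
  qed
qed

section \<open>Survival probabilities\<close>

lemma survivors_eq: "survivors \<gamma> H t = {x \<in> II. \<forall>i\<le>t. (T \<gamma> ^^ i) x \<notin> H}"
  using T_pow_II by (auto simp: survivors_def preim_def)

lemma survivors_antimono: "s \<le> t \<Longrightarrow> survivors \<gamma> H t \<subseteq> survivors \<gamma> H s"
  by (auto simp: survivors_eq)

lemma survivors_borel [measurable]: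
  assumes [measurable]: "H \<in> sets borel"
  shows "survivors \<gamma> H t \<in> sets borel"
  unfolding survivors_eq by measurable

lemma survivors_shift:
  assumes "x \<in> survivors \<gamma> H (m + t)"
  shows "(T \<gamma> ^^ m) x \<in> survivors \<gamma> H t"
proof -
  have "(T \<gamma> ^^ i) ((T \<gamma> ^^ m) x) \<notin> H" if "i \<le> t" for i
    using assms that by (auto simp: survivors_eq funpow_add[symmetric, THEN fun_cong, unfolded o_def])
  thus ?thesis using assms T_pow_II by (auto simp: survivors_eq)
qed

text \<open>
  Follow the mass until it passes through the right half. What passes within \<open>k\<close> steps has a balanced
  density afterwards and still has at least \<open>d\<close> steps to survive, so the assumption bounds its
  surviving part; what does not pass started below \<open>b k\<close>.
\<close>

lemma mass_excursion:
  assumes [measurable]: "H \<in> sets borel"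
    and c: "\<And>g. balanced g \<Longrightarrow> mass g (survivors \<gamma> H d) \<le> ennreal c * mass g UNIV"
    and h: "lsv_cone h"
  shows "mass h (survivors \<gamma> H (k + d)) \<le> ennreal c * mass h UNIV + mass h {..<b k}"
  using h
proof (induction k arbitrary: h)
  case 0
  have "mass h (survivors \<gamma> H d) \<le> mass h {..<1}" by (rule mass_mono) auto
  thus ?case by (auto intro: order_trans)
next
  case (Suc k)
  let ?S = "survivors \<gamma> H (k + d)"
  have "mass h (survivors \<gamma> H (Suc k + d)) \<le> mass h {x. T \<gamma> x \<in> ?S}"
    using survivors_shift[of _ H 1 "k + d"] by (intro mass_mono) auto
  also have "\<dots> = mass (PL h) ?S + mass (PR h) ?S"
    by (rule mass_preimage[OF Suc.prems]) auto
  also have "\<dots> \<le> (ennreal c * mass (PL h) UNIV + mass (PL h) {..<b k}) + ennreal c * mass (PR h) UNIV"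
  proof (rule add_mono)
    show "mass (PL h) ?S \<le> ennreal c * mass (PL h) UNIV + mass (PL h) {..<b k}"
      by (rule Suc.IH[OF cone_PL[OF Suc.prems]])
    have "mass (PR h) ?S \<le> mass (PR h) (survivors \<gamma> H d)"
      using survivors_antimono[of d "k + d" H] by (intro mass_mono) auto
    also have "\<dots> \<le> ennreal c * mass (PR h) UNIV"
      by (rule c[OF balanced_PR[OF Suc.prems]])
    finally show "mass (PR h) ?S \<le> ennreal c * mass (PR h) UNIV" .
  qed
  also have "\<dots> = ennreal c * (mass (PL h) UNIV + mass (PR h) UNIV) + mass (PL h) {..<b k}"
    by (simp add: distrib_left ac_simps)
  also have "mass (PL h) UNIV + mass (PR h) UNIV = mass h UNIV"
    using mass_preimage[OF Suc.prems, of UNIV] by simp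
  also have "mass (PL h) {..<b k} = mass h {x. x < 1/2 \<and> T \<gamma> x \<in> {..<b k}}"
    by (rule mass_PL[OF Suc.prems, symmetric]) auto
  also have "\<dots> \<le> mass h {..<b (Suc k)}"
  proof (rule mass_mono; safe)
    fix x :: real assume x: "x < 1/2" "T \<gamma> x < b k" "x \<in> {0<..<1}"
    hence "TL \<gamma> x < TL \<gamma> (b (Suc k))" by (simp add: T_left TL_b_Suc)
    thus "x < b (Suc k)" using x b_pos[of "Suc k"] by (subst (asm) TL_less_iff) auto
  qed
  finally show ?case by (simp add: add_left_mono)
qed

text \<open>
  During the first \<open>N\<close> steps a proportion \<open>1 - \<rho>\<close> falls into the hole. The rest has a density \<open>h\<close>
  in the cone that need not be balanced, but is bounded by a multiple of the total mass of \<open>g\<close>;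
  hence \<open>mass_excursion\<close> applies to it and the mass near \<open>0\<close> is of the order of \<open>b k\<close>.
\<close>

lemma renewal_step:
  assumes det: "determined N H"
    and \<rho>: "\<And>g G. balanced g \<Longrightarrow> mass g UNIV = ennreal G \<Longrightarrow> 0 \<le> G \<Longrightarrow> mass g (II - H) \<le> ennreal (\<rho> * G)" "0 < \<rho>"
    and c: "\<And>g. balanced g \<Longrightarrow> mass g (survivors \<gamma> H d) \<le> ennreal c * mass g UNIV" "0 \<le> c"
    and g: "balanced g"
  shows "mass g (survivors \<gamma> H (N + k + d)) \<le> ennreal (\<rho> * c + 2 ^ N * K * b k) * mass g UNIV"
proof -
  note [measurable] = determined_borel[OF det]
  have cone: "lsv_cone g" using g by (simp add: balanced_def)
  obtain G where G: "0 \<le> G" "mass g UNIV = ennreal G" and "\<forall>x\<in>{0<..<1}. g x \<le> K * G"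
    using balanced_bounds[OF g] by blast
  then obtain h where h: "lsv_cone h" "\<forall>x\<in>{0<..<1}. h x \<le> 2 ^ N * (K * G)"
    and push: "\<And>A. A \<in> sets borel \<Longrightarrow> mass h A = mass g {x \<in> II. x \<notin> H \<and> (T \<gamma> ^^ N) x \<in> A}"
    using restricted_pushforward[OF det cone, of "K * G"] by auto
  have nonneg: "0 \<le> \<rho> * G" "0 \<le> 2 ^ N * (K * G)"
    using G \<rho>(2) K_ge_1 by auto
  have "survivors \<gamma> H (N + k + d) \<subseteq> {x \<in> II. x \<notin> H \<and> (T \<gamma> ^^ N) x \<in> survivors \<gamma> H (k + d)}"
  proof
    fix x assume x: "x \<in> survivors \<gamma> H (N + k + d)"
    hence "x \<in> II" "x \<notin> H" by (force simp: survivors_eq)+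
    thus "x \<in> {x \<in> II. x \<notin> H \<and> (T \<gamma> ^^ N) x \<in> survivors \<gamma> H (k + d)}"
      using survivors_shift[of x H N "k + d"] x by (simp add: add.assoc)
  qed
  hence "mass g (survivors \<gamma> H (N + k + d)) \<le> mass g {x \<in> II. x \<notin> H \<and> (T \<gamma> ^^ N) x \<in> survivors \<gamma> H (k + d)}"
    by (intro mass_mono) auto
  also have "\<dots> = mass h (survivors \<gamma> H (k + d))" by (rule push[symmetric]) measurable
  also have "\<dots> \<le> ennreal c * mass h UNIV + mass h {..<b k}"
    by (rule mass_excursion[OF determined_borel[OF det] c(1) h(1)])
  also have "\<dots> \<le> ennreal c * ennreal (\<rho> * G) + ennreal (2 ^ N * (K * G) * b k)"
  proof (intro add_mono mult_left_mono)
    have "mass h UNIV \<le> mass g (II - H)"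
      by (subst push) (auto intro!: mass_mono)
    also have "\<dots> \<le> ennreal (\<rho> * G)" by (rule \<rho>(1)[OF g G(2,1)])
    finally show "mass h UNIV \<le> ennreal (\<rho> * G)" .
    have "mass h {..<b k} \<le> mass (\<lambda>_. 2 ^ N * (K * G)) {..<b k}"
      using h(2) by (intro mass_mono_fun) auto
    also have "\<dots> = ennreal (2 ^ N * (K * G)) * emeasure lborel ({..<b k} \<inter> {0<..<1})"
      by (rule mass_const) auto
    also have "{..<b k} \<inter> {0<..<1} = {0<..<b k}" using b_le_1[of k] by auto
    also have "emeasure lborel {0<..<b k} = ennreal (b k)"
      using b_pos[of k] by simp
    also have "ennreal (2 ^ N * (K * G)) * ennreal (b k) = ennreal (2 ^ N * (K * G) * b k)"
      using nonneg b_pos[of k] by (intro ennreal_mult[symmetric]) auto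
    finally show "mass h {..<b k} \<le> ennreal (2 ^ N * (K * G) * b k)" .
  qed auto
  also have "\<dots> = ennreal (c * (\<rho> * G) + 2 ^ N * (K * G) * b k)"
    using nonneg c(2) b_pos[of k] by (simp add: ennreal_mult ennreal_plus)
  also have "c * (\<rho> * G) + 2 ^ N * (K * G) * b k = (\<rho> * c + 2 ^ N * K * b k) * G"
    by (simp add: algebra_simps)
  also have "ennreal \<dots> = ennreal (\<rho> * c + 2 ^ N * K * b k) * mass g UNIV"
    unfolding G(2) using G(1) \<rho>(2) c(2) K_ge_1 b_pos[of k]
    by (intro ennreal_mult add_nonneg_nonneg mult_nonneg_nonneg) auto
  finally show ?thesis .
qed

end

section \<open>Polynomial decay from a renewal inequality\<close>

text \<open>
  Read \<open>P t c\<close> as \<open>u\<^sub>t \<le> c\<close>. With \<open>k\<close> close to \<open>\<epsilon> t\<close>, the remaining time \<open>d\<close> is at least \<open>\<theta> t\<close>, where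
  \<open>\<theta> = 1 - 2 \<epsilon>\<close> is chosen so that the loss \<open>\<theta>\<^sup>-\<^sup>\<beta>\<close> in the induction hypothesis only replaces \<open>\<rho>\<close> by \<open>\<rho>' < 1\<close>.
  The remaining room \<open>1 - \<rho>'\<close> absorbs the inhomogeneous term if \<open>C\<close> is large.
\<close>

lemma renewal_decay:
  fixes P :: "nat \<Rightarrow> real \<Rightarrow> bool"
  assumes "0 < \<rho>" "\<rho> < 1" "0 < \<beta>" "0 \<le> D"
    and base: "\<And>t. P t 1"
    and mono: "\<And>t c c'. P t c \<Longrightarrow> c \<le> c' \<Longrightarrow> P t c'"
    and step: "\<And>d k c. 0 \<le> c \<Longrightarrow> P d c \<Longrightarrow> P (N + k + d) (\<rho> * c + D * (real k + 1) powr (-\<beta>))"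
  obtains C where "0 < C" "\<And>t. 1 \<le> t \<Longrightarrow> P t (C * real t powr (-\<beta>))"
proof -
  define \<rho>' where "\<rho>' = (1 + \<rho>) / 2"
  have \<rho>': "\<rho> < \<rho>'" "\<rho>' < 1" "0 < \<rho>'" using assms(1,2) by (auto simp: \<rho>'_def)
  define \<theta> where "\<theta> = (\<rho> / \<rho>') powr (1 / \<beta>)"
  have "0 < \<theta>" using assms(1) \<rho>' by (simp add: \<theta>_def)
  have "\<theta> < 1"
    using powr_less_mono2[of "1/\<beta>" "\<rho> / \<rho>'" 1] assms(1,3) \<rho>' by (simp add: \<theta>_def)
  have \<theta>_powr: "\<theta> powr (-\<beta>) = \<rho>' / \<rho>"
    using assms(1,3) \<rho>' by (simp add: \<theta>_def powr_powr powr_minus)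
  define \<epsilon> where "\<epsilon> = (1 - \<theta>) / 2"
  have \<epsilon>: "0 < \<epsilon>" using \<open>\<theta> < 1\<close> by (simp add: \<epsilon>_def)
  define t0 where "t0 = nat \<lceil>(real N + 1) / \<epsilon>\<rceil>"
  define E where "E = D * \<epsilon> powr (-\<beta>)"
  define C where "C = max (max 1 (real t0 powr \<beta>)) (E / (1 - \<rho>'))"
  have C: "1 \<le> C" "real t0 powr \<beta> \<le> C" "E / (1 - \<rho>') \<le> C" by (auto simp: C_def)
  have P: "P t (C * real t powr (-\<beta>))" if "1 \<le> t" for t
    using that
  proof (induction t rule: less_induct)
    case (less t)
    show ?case
    proof (cases "t \<le> t0")
      case True
      have "1 = real t powr \<beta> * real t powr (-\<beta>)" using less.prems by (simp add: powr_minus)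
      also have "\<dots> \<le> C * real t powr (-\<beta>)"
      proof (intro mult_right_mono)
        have "real t powr \<beta> \<le> real t0 powr \<beta>" using True assms(3) by (intro powr_mono2) auto
        thus "real t powr \<beta> \<le> C" using C(2) by simp
      qed auto
      finally show ?thesis by (rule mono[OF base])
    next
      case False
      define k where "k = nat \<lfloor>\<epsilon> * real t\<rfloor>"
      have "(real N + 1) / \<epsilon> \<le> real t" using False unfolding t0_def by linarith
      hence N: "real N + 1 \<le> \<epsilon> * real t" using \<epsilon> by (simp add: field_simps)
      have k: "real k \<le> \<epsilon> * real t" "\<epsilon> * real t \<le> real k + 1"
        using \<epsilon> by (auto simp: k_def)
      have "real N + real k \<le> 2 * (\<epsilon> * real t) - 1" using N k by linarith
      also have "\<dots> = real t - \<theta> * real t - 1" by (simp add: \<epsilon>_def field_simps)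
      finally have Nk: "\<theta> * real t + 1 \<le> real t - (real N + real k)" by simp
      have "0 < \<theta> * real t" using \<open>0 < \<theta>\<close> less.prems by simp
      hence "N + k < t" using Nk by linarith
      define d where "d = t - (N + k)"
      have t: "t = N + k + d" using \<open>N + k < t\<close> by (simp add: d_def)
      have "1 \<le> d" using \<open>N + k < t\<close> by (simp add: d_def)
      have "1 \<le> k" using N unfolding k_def by linarith
      hence "d < t" using t by simp
      have d: "\<theta> * real t \<le> real d" using Nk t by simp
      have "P d (C * real d powr (-\<beta>))" by (rule less.IH[OF \<open>d < t\<close> \<open>1 \<le> d\<close>])
      moreover have "real d powr (-\<beta>) \<le> (\<theta> * real t) powr (-\<beta>)"
        using d \<open>0 < \<theta> * real t\<close> assms(3) by (intro powr_mono2') auto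
      hence "C * real d powr (-\<beta>) \<le> C * (\<theta> * real t) powr (-\<beta>)"
        using C by (intro mult_left_mono) auto
      ultimately have "P d (C * (\<theta> * real t) powr (-\<beta>))" by (rule mono)
      hence "P t (\<rho> * (C * (\<theta> * real t) powr (-\<beta>)) + D * (real k + 1) powr (-\<beta>))"
        unfolding t using C by (intro step) auto
      moreover have "\<rho> * (C * (\<theta> * real t) powr (-\<beta>)) + D * (real k + 1) powr (-\<beta>) \<le> C * real t powr (-\<beta>)"
      proof -
        have "(\<theta> * real t) powr (-\<beta>) = \<rho>' / \<rho> * real t powr (-\<beta>)"
          unfolding \<theta>_powr[symmetric] by (rule powr_mult)
        hence "\<rho> * (C * (\<theta> * real t) powr (-\<beta>)) = \<rho>' * C * real t powr (-\<beta>)"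
          using assms(1) by simp
        moreover have "D * (real k + 1) powr (-\<beta>) \<le> D * (\<epsilon> * real t) powr (-\<beta>)"
          using k \<epsilon> less.prems assms(3,4) by (intro mult_left_mono powr_mono2') auto
        moreover have "D * (\<epsilon> * real t) powr (-\<beta>) = E * real t powr (-\<beta>)"
          by (simp add: E_def powr_mult)
        moreover have "E \<le> (1 - \<rho>') * C" using C(3) \<rho>' by (simp add: divide_le_eq mult.commute)
        hence "E * real t powr (-\<beta>) \<le> (1 - \<rho>') * C * real t powr (-\<beta>)"
          by (intro mult_right_mono) auto
        moreover have "(1 - \<rho>') * C * real t powr (-\<beta>) = C * real t powr (-\<beta>) - \<rho>' * C * real t powr (-\<beta>)"
          by (simp add: left_diff_distrib)
        ultimately show ?thesis by linarith
      qed
      ultimately show ?thesis by (rule mono)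
    qed
  qed
  show ?thesis by (rule that[of C]) (use C P in auto)
qed

section \<open>Survival of balanced and of power densities\<close>

context neutral_map
begin

lemma balanced_survival:
  assumes "determined N H" "H \<noteq> {}"
  obtains C where "0 < C"
    "\<And>t g. 1 \<le> t \<Longrightarrow> balanced g \<Longrightarrow>
       mass g (survivors \<gamma> H t) \<le> ennreal (C * real t powr (-(1/\<gamma>))) * mass g UNIV"
proof -
  obtain \<rho> where \<rho>: "0 < \<rho>" "\<rho> < 1"
    "\<And>g G. balanced g \<Longrightarrow> mass g UNIV = ennreal G \<Longrightarrow> 0 \<le> G \<Longrightarrow> mass g (II - H) \<le> ennreal (\<rho> * G)"
    using mass_avoiding_le[OF assms] by metis
  define P where "P = (\<lambda>t c. \<forall>g. balanced g \<longrightarrow> mass g (survivors \<gamma> H t) \<le> ennreal c * mass g UNIV)"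
  define D where "D = 2 ^ N * K * (\<gamma> / 2) powr (-1/\<gamma>)"
  have P_mono: "P t c'" if "P t c" "c \<le> c'" for t c c'
    unfolding P_def
  proof (intro allI impI)
    fix g assume "balanced g"
    hence "mass g (survivors \<gamma> H t) \<le> ennreal c * mass g UNIV" using that(1) by (simp add: P_def)
    also have "\<dots> \<le> ennreal c' * mass g UNIV"
      using that(2) by (intro mult_right_mono ennreal_leI) auto
    finally show "mass g (survivors \<gamma> H t) \<le> ennreal c' * mass g UNIV" .
  qed
  obtain C where C: "0 < C" "\<And>t. 1 \<le> t \<Longrightarrow> P t (C * real t powr (-(1/\<gamma>)))"
  proof (rule renewal_decay[of \<rho> "1/\<gamma>" D P N])
    show "0 < \<rho>" "\<rho> < 1" by fact+
    show "0 < 1/\<gamma>" using \<gamma>_pos by simp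
    show "0 \<le> D" using K_ge_1 by (simp add: D_def)
    show "P t 1" for t by (auto simp: P_def intro: mass_mono)
    show "P t c'" if "P t c" "c \<le> c'" for t c c' using P_mono[OF that] .
    show "P (N + k + d) (\<rho> * c + D * (real k + 1) powr (-(1/\<gamma>)))" if "0 \<le> c" "P d c" for d k c
    proof (rule P_mono)
      show "P (N + k + d) (\<rho> * c + 2 ^ N * K * b k)"
        using renewal_step[OF assms(1) \<rho>(3,1) _ that(1)] that(2) by (simp add: P_def)
      have "2 ^ N * K * b k \<le> 2 ^ N * K * ((\<gamma> / 2) powr (-1/\<gamma>) * (real k + 1) powr (-1/\<gamma>))"
        using K_ge_1 b_le[of k] by (intro mult_left_mono) auto
      thus "\<rho> * c + 2 ^ N * K * b k \<le> \<rho> * c + D * (real k + 1) powr (-(1/\<gamma>))"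
        by (simp add: D_def mult.assoc)
    qed
  qed blast
  show ?thesis by (rule that[OF C(1)]) (use C(2) in \<open>auto simp: P_def\<close>)
qed

lemma cone_powr:
  assumes "0 \<le> \<alpha>" "\<alpha> < 1"
  shows "lsv_cone (\<lambda>x. x powr (-\<alpha>))"
proof (rule coneI)
  fix x y :: real assume xy: "0 < x" "x \<le> y"
  show "y powr (-\<alpha>) \<le> x powr (-\<alpha>)" using xy assms by (intro powr_mono2') auto
  have "x powr (\<gamma> + 1 + -\<alpha>) \<le> y powr (\<gamma> + 1 + -\<alpha>)"
    using xy assms \<gamma>_pos by (intro powr_mono2) auto
  thus "x powr (\<gamma> + 1) * x powr (-\<alpha>) \<le> y powr (\<gamma> + 1) * y powr (-\<alpha>)"
    by (simp only: powr_add)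
qed auto

lemma mass_powr_le:
  assumes "0 \<le> \<alpha>" "\<alpha> < 1" "0 \<le> r"
  shows "mass (\<lambda>x. x powr (-\<alpha>)) {..<r} \<le> ennreal (r powr (1 - \<alpha>) / (1 - \<alpha>))"
proof -
  have "((\<lambda>x. x powr (-\<alpha>)) has_integral (r powr (-\<alpha> + 1) / (-\<alpha> + 1))) {0..r}"
    using assms by (intro has_integral_powr_from_0) auto
  hence "(\<integral>\<^sup>+ x. ennreal (x powr (-\<alpha>)) * indicator {0..r} x \<partial>lborel) = ennreal (r powr (-\<alpha> + 1) / (-\<alpha> + 1))"
    by (intro nn_integral_has_integral_lebesgue') auto
  moreover have "mass (\<lambda>x. x powr (-\<alpha>)) {..<r} \<le> (\<integral>\<^sup>+ x. ennreal (x powr (-\<alpha>)) * indicator {0..r} x \<partial>lborel)"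
    unfolding mass_def by (intro nn_integral_mono) (auto split: split_indicator)
  ultimately show ?thesis by (simp add: add.commute)
qed

lemma mass_powr_ge:
  assumes "0 \<le> \<alpha>" "0 < r" "r \<le> 1"
  shows "ennreal (r powr (1 - \<alpha>)) \<le> mass (\<lambda>x. x powr (-\<alpha>)) {..<r}"
proof -
  have "ennreal (r powr (1 - \<alpha>)) = ennreal (r powr (-\<alpha>)) * ennreal r"
    using assms by (simp add: ennreal_mult[symmetric] powr_diff powr_minus field_simps)
  also have "ennreal r = emeasure lborel {0<..<r}" using assms by simp
  also have "ennreal (r powr (-\<alpha>)) * emeasure lborel {0<..<r} = mass (\<lambda>_. r powr (-\<alpha>)) {0<..<r}"
    using assms by (subst mass_const) (auto intro!: arg_cong2[where f = "(*)"] arg_cong[where f = "emeasure _"])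
  also have "\<dots> \<le> mass (\<lambda>x. x powr (-\<alpha>)) {..<r}"
    unfolding mass_def using assms
    by (intro nn_integral_mono) (auto split: split_indicator intro!: ennreal_leI powr_mono2')
  finally show ?thesis .
qed

text \<open>
  With \<open>k\<close> half of \<open>t\<close>, what survives of the mass that leaves \<open>(0, b k)\<close> in time has order at most
  \<open>t\<^sup>-\<^sup>1\<^sup>/\<^sup>\<gamma>\<close> and is dominated by the bound \<open>(b k)\<^sup>1\<^sup>-\<^sup>\<alpha> / (1 - \<alpha>)\<close> for the mass
  that does not.
\<close>

lemma powr_survival_upper:
  assumes "determined N H" "H \<noteq> {}" "0 \<le> \<alpha>" "\<alpha> < 1"
  obtains C where "0 < C"
    "\<And>t. 1 \<le> t \<Longrightarrow> mass (\<lambda>x. x powr (-\<alpha>)) (survivors \<gamma> H t) \<le> ennreal (C * real t powr (-((1 - \<alpha>) / \<gamma>)))"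
proof -
  let ?f = "\<lambda>x::real. x powr (-\<alpha>)"
  define \<beta> where "\<beta> = (1 - \<alpha>) / \<gamma>"
  have \<beta>: "0 < \<beta>" "\<beta> \<le> 1 / \<gamma>" using assms \<gamma>_pos by (auto simp: \<beta>_def divide_right_mono)
  obtain C where C: "0 < C" "\<And>t g. 1 \<le> t \<Longrightarrow> balanced g \<Longrightarrow>
       mass g (survivors \<gamma> H t) \<le> ennreal (C * real t powr (-(1/\<gamma>))) * mass g UNIV"
    using balanced_survival[OF assms(1,2)] by metis
  define B where "B = (\<gamma> / 2) powr (-1/\<gamma>)"
  define C' where "C' = (C + B powr (1 - \<alpha>)) / (1 - \<alpha>) * 2 powr \<beta>"
  show ?thesis
  proof
    have "0 < C + B powr (1 - \<alpha>)" using C(1) by (intro add_pos_nonneg) auto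
    thus "0 < C'" using assms by (simp add: C'_def)
  next
    fix t :: nat assume t: "1 \<le> t"
    define k where "k = t div 2"
    define d where "d = t - k"
    have tkd: "t = k + d" and d: "1 \<le> d" using t by (auto simp: d_def k_def)
    have "t \<le> 2 * d" "t \<le> 2 * k + 1" by (auto simp: d_def k_def)
    hence half: "real t / 2 \<le> real d" "real t / 2 \<le> real k + 1" by linarith+
    have t_powr: "(real t / 2) powr (-\<beta>) = 2 powr \<beta> * real t powr (-\<beta>)"
      by (simp add: powr_divide powr_minus field_simps)
    have bound1: "C * real d powr (-(1/\<gamma>)) * (1 / (1 - \<alpha>)) \<le> C * (real t / 2) powr (-\<beta>) / (1 - \<alpha>)"
    proof -
      have "real d powr (-(1/\<gamma>)) \<le> real d powr (-\<beta>)" using d \<beta> by (intro powr_mono) auto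
      also have "\<dots> \<le> (real t / 2) powr (-\<beta>)" using half t \<beta> by (intro powr_mono2') auto
      finally show ?thesis using C(1) assms by (auto intro!: divide_right_mono mult_left_mono)
    qed
    have bound2: "b k powr (1 - \<alpha>) / (1 - \<alpha>) \<le> B powr (1 - \<alpha>) * (real t / 2) powr (-\<beta>) / (1 - \<alpha>)"
    proof -
      have "b k powr (1 - \<alpha>) \<le> (B * (real k + 1) powr (-1/\<gamma>)) powr (1 - \<alpha>)"
        using b_le[of k] b_pos[of k] assms by (intro powr_mono2) (auto simp: B_def)
      also have "\<dots> = B powr (1 - \<alpha>) * (real k + 1) powr (-\<beta>)"
        by (simp add: powr_mult powr_powr \<beta>_def)
      also have "\<dots> \<le> B powr (1 - \<alpha>) * (real t / 2) powr (-\<beta>)"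
        using half t \<beta> by (intro mult_left_mono powr_mono2') auto
      finally show ?thesis using assms by (intro divide_right_mono) auto
    qed
    have "mass ?f (survivors \<gamma> H t) \<le> ennreal (C * real d powr (-(1/\<gamma>))) * mass ?f UNIV + mass ?f {..<b k}"
      unfolding tkd
      by (rule mass_excursion[OF determined_borel[OF assms(1)] C(2)[OF d] cone_powr[OF assms(3,4)]])
    also have "\<dots> \<le> ennreal (C * real d powr (-(1/\<gamma>))) * ennreal (1 / (1 - \<alpha>)) + ennreal (b k powr (1 - \<alpha>) / (1 - \<alpha>))"
    proof (intro add_mono mult_left_mono)
      have "mass ?f UNIV \<le> mass ?f {..<1}" by (intro mass_mono) auto
      also have "\<dots> \<le> ennreal (1 / (1 - \<alpha>))" using mass_powr_le[OF assms(3,4), of 1] by simp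
      finally show "mass ?f UNIV \<le> ennreal (1 / (1 - \<alpha>))" .
      show "mass ?f {..<b k} \<le> ennreal (b k powr (1 - \<alpha>) / (1 - \<alpha>))"
        using b_pos[of k] by (intro mass_powr_le assms) auto
    qed auto
    also have "\<dots> = ennreal (C * real d powr (-(1/\<gamma>)) * (1 / (1 - \<alpha>)) + b k powr (1 - \<alpha>) / (1 - \<alpha>))"
      using C(1) assms by (subst ennreal_mult[symmetric]) (auto simp: ennreal_plus)
    also have "\<dots> \<le> ennreal (C * (real t / 2) powr (-\<beta>) / (1 - \<alpha>) + B powr (1 - \<alpha>) * (real t / 2) powr (-\<beta>) / (1 - \<alpha>))"
      by (intro ennreal_leI add_mono bound1 bound2)
    also have "C * (real t / 2) powr (-\<beta>) / (1 - \<alpha>) + B powr (1 - \<alpha>) * (real t / 2) powr (-\<beta>) / (1 - \<alpha>)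
        = C' * real t powr (-\<beta>)"
      unfolding t_powr C'_def by (simp add: add_divide_distrib distrib_right mult.assoc)
    finally show "mass ?f (survivors \<gamma> H t) \<le> ennreal (C' * real t powr (-((1 - \<alpha>) / \<gamma>)))"
      by (simp add: \<beta>_def)
  qed
qed

section \<open>Holes from the refined partition\<close>

lemma J_elem_eq: "J_elem \<gamma> n = {b (Suc n)..<b n}"
  by (cases n) (auto simp: J_elem_def a_seq_eq b_1)

lemma J_elem_iff:
  assumes "x \<in> II"
  shows "x \<in> J_elem \<gamma> n \<longleftrightarrow> (\<forall>i<n. (T \<gamma> ^^ i) x < 1/2) \<and> 1/2 \<le> (T \<gamma> ^^ n) x"
  using assms
proof (induction n arbitrary: x)
  case 0
  thus ?case by (auto simp: J_elem_eq b_1 II_def)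
next
  case (Suc n)
  have "x \<in> J_elem \<gamma> (Suc n) \<longleftrightarrow> x < 1/2 \<and> T \<gamma> x \<in> J_elem \<gamma> n"
  proof (cases "x < 1/2")
    case True
    have "b (Suc (Suc n)) \<le> x \<longleftrightarrow> b (Suc n) \<le> TL \<gamma> x"
      using TL_less_iff[of x "b (Suc (Suc n))"] b_pos[of "Suc (Suc n)"] Suc.prems
      by (auto simp: TL_b_Suc II_def not_less[symmetric])
    moreover have "x < b (Suc n) \<longleftrightarrow> TL \<gamma> x < b n"
      using TL_less_iff[of x "b (Suc n)"] b_pos[of "Suc n"] Suc.prems
      by (auto simp: TL_b_Suc II_def)
    ultimately show ?thesis using True by (simp add: J_elem_eq T_left)
  next
    case False
    thus ?thesis using b_Suc_le_half[of n] by (auto simp: J_elem_eq)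
  qed
  also have "\<dots> \<longleftrightarrow> x < 1/2 \<and> (\<forall>i<n. (T \<gamma> ^^ Suc i) x < 1/2) \<and> 1/2 \<le> (T \<gamma> ^^ Suc n) x"
    unfolding Suc.IH[OF T_II[OF Suc.prems]] by (simp add: funpow_Suc_right del: funpow.simps(2))
  also have "\<dots> \<longleftrightarrow> (\<forall>i<Suc n. (T \<gamma> ^^ i) x < 1/2) \<and> 1/2 \<le> (T \<gamma> ^^ Suc n) x"
    unfolding All_less_Suc2 by simp
  finally show ?case .
qed

text \<open>
  Belonging to \<open>J_elem \<gamma> n\<close> is a condition on the first \<open>n + 1\<close> symbols, and the other factors of the
  refinement are conditions on the first \<open>l + 1\<close>.
\<close>

lemma part_Jt_determined:
  assumes "H \<in> part_Jt \<gamma> l"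
  obtains N n where "determined N H" "H \<noteq> {}" "H \<subseteq> J_elem \<gamma> n"
proof -
  from assms obtain A B where H: "H = A \<inter> B" "H \<noteq> {}" and A: "A \<in> part_J \<gamma>"
    and B: "B \<in> refine_upto l (\<lambda>i. preim \<gamma> i ` part_P)"
    unfolding part_Jt_def refine2_def by blast
  from A obtain n where n: "A = J_elem \<gamma> n" unfolding part_J_def by blast
  from B obtain C where C: "B = (\<Inter>i\<le>l. C i)" "\<forall>i\<le>l. C i \<in> preim \<gamma> i ` part_P"
    unfolding refine_upto_def by blast
  define N where "N = max (Suc l) (Suc n)"
  have "determined N H" unfolding determined_def
  proof (intro conjI ballI impI)
    have "B \<subseteq> II" using C by (force simp: preim_def)
    thus "H \<subseteq> II" using H by blast
    fix x y assume x: "x \<in> II" and y: "y \<in> II"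
      and sym: "\<forall>i<N. (T \<gamma> ^^ i) x < 1/2 \<longleftrightarrow> (T \<gamma> ^^ i) y < 1/2"
    have "x \<in> A \<longleftrightarrow> y \<in> A"
      unfolding n J_elem_iff[OF x] J_elem_iff[OF y] using sym by (auto simp: N_def not_less[symmetric])
    moreover have "x \<in> C i \<longleftrightarrow> y \<in> C i" if i: "i \<le> l" for i
    proof -
      obtain Q where Q: "C i = preim \<gamma> i Q" "Q \<in> part_P" using C(2) i by blast
      have "(T \<gamma> ^^ i) x < 1/2 \<longleftrightarrow> (T \<gamma> ^^ i) y < 1/2" using sym i by (simp add: N_def)
      hence "(T \<gamma> ^^ i) x \<in> Q \<longleftrightarrow> (T \<gamma> ^^ i) y \<in> Q"
        using Q(2) T_pow_II[OF x, of i] T_pow_II[OF y, of i]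
        unfolding part_P_def by (elim insertE emptyE) (auto simp: II_def)
      thus ?thesis using x y by (simp add: Q(1) preim_def)
    qed
    ultimately show "x \<in> H \<longleftrightarrow> y \<in> H" using H C by blast
  qed
  thus ?thesis using that[of N n] H n by blast
qed

lemma T_pow_near_0:
  assumes "x \<in> {0..<b (m + n)}"
  shows "(T \<gamma> ^^ m) x \<in> {0..<b n}"
  using assms
proof (induction m arbitrary: x)
  case (Suc m)
  have x: "0 \<le> x" "x < b (Suc (m + n))" using Suc.prems by auto
  hence "x < 1/2" using b_Suc_le_half[of "m + n"] by simp
  moreover have "TL \<gamma> x < b (m + n)" using TL_strict_mono[OF x] by (simp add: TL_b_Suc)
  ultimately have "T \<gamma> x \<in> {0..<b (m + n)}" using TL_ge[of x] x by (simp add: T_left)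
  thus ?case unfolding funpow_Suc_right o_def by (rule Suc.IH)
qed auto

lemma survivors_near_0:
  assumes "H \<inter> {..<b k} = {}"
  shows "{0..<b (t + k)} \<subseteq> survivors \<gamma> H t"
proof
  fix x assume x: "x \<in> {0..<b (t + k)}"
  have "(T \<gamma> ^^ i) x \<notin> H" if "i \<le> t" for i
  proof -
    have "x \<in> {0..<b (i + (t - i + k))}" using x that by simp
    hence "(T \<gamma> ^^ i) x \<in> {0..<b (t - i + k)}" by (rule T_pow_near_0)
    moreover have "b (t - i + k) \<le> b k" by (rule b_antimono) simp
    ultimately show ?thesis using assms by force
  qed
  moreover have "x \<in> II" using x b_le_1[of "t + k"] by (auto simp: II_def)
  ultimately show "x \<in> survivors \<gamma> H t" by (simp add: survivors_eq)
qed

lemma b_small: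
  assumes "0 < x"
  obtains m where "b m \<le> x"
proof -
  obtain m :: nat where m: "x powr (-\<gamma>) * 2 / \<gamma> < real m" using reals_Archimedean2 by blast
  have "b m \<le> x"
  proof (rule ccontr)
    assume "\<not> b m \<le> x"
    hence "b m powr (-\<gamma>) \<le> x powr (-\<gamma>)" using assms \<gamma>_pos by (intro powr_mono2') auto
    hence "\<gamma> / 2 * (real m + 1) \<le> x powr (-\<gamma>)" using b_powr_bounds(1)[of m] by simp
    thus False using m \<gamma>_pos by (simp add: field_simps)
  qed
  thus ?thesis by (rule that)
qed

section \<open>Measures with a power-like density\<close>

lemma emeasure_mu:
  assumes "integrable leb f" "S \<in> sets borel" "S \<subseteq> II"
  shows "emeasure (mu f) S = (\<integral>\<^sup>+ x. ennreal (f x) * indicator S x \<partial>lborel)"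
proof -
  have [measurable]: "f \<in> borel_measurable leb" using assms(1) by (rule borel_measurable_integrable)
  have "S \<in> sets leb" using assms by (auto simp: leb_def sets_restrict_space_iff)
  hence "emeasure (mu f) S = (\<integral>\<^sup>+ x. ennreal (f x) * indicator S x \<partial>leb)"
    unfolding mu_def by (intro emeasure_density) auto
  also have "\<dots> = (\<integral>\<^sup>+ x. ennreal (f x) * indicator S x * indicator II x \<partial>lebesgue)"
    unfolding leb_def by (intro nn_integral_restrict_space) auto
  also have "\<dots> = (\<integral>\<^sup>+ x. ennreal (f x) * indicator S x * indicator II x \<partial>lborel)"
    by (rule nn_integral_completion)
  also have "\<dots> = (\<integral>\<^sup>+ x. ennreal (f x) * indicator S x \<partial>lborel)"
    using assms(3) by (intro nn_integral_cong) (auto split: split_indicator)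
  finally show ?thesis .
qed

lemma emeasure_mu_le:
  assumes "integrable leb f" "S \<in> sets borel" "S \<subseteq> II" "\<And>x. 0 < x \<Longrightarrow> x < 1 \<Longrightarrow> f x \<le> g x"
  shows "emeasure (mu f) S \<le> mass g S"
  unfolding emeasure_mu[OF assms(1-3)] mass_def
proof (rule nn_integral_mono_AE)
  have "ennreal (f x) * indicator S x \<le> ennreal (g x) * indicator (S \<inter> {0<..<1}) x" if "x \<noteq> 0" for x
    using assms(3,4) that by (auto simp: II_def split: split_indicator intro!: ennreal_leI)
  thus "AE x in lborel. ennreal (f x) * indicator S x \<le> ennreal (g x) * indicator (S \<inter> {0<..<1}) x"
    using AE_lborel_singleton[of 0] by (auto elim!: eventually_mono)
qed

lemma mass_le_emeasure_mu:
  assumes "integrable leb f" "S \<in> sets borel" "S \<subseteq> II" "A \<subseteq> S"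
    "\<And>x. 0 < x \<Longrightarrow> x \<in> A \<Longrightarrow> g x \<le> f x"
  shows "mass g A \<le> emeasure (mu f) S"
  unfolding emeasure_mu[OF assms(1-3)] mass_def
  using assms(4,5) by (intro nn_integral_mono) (auto split: split_indicator intro!: ennreal_leI)

text \<open>
  For the lower bound, \<open>k\<close> is so large that \<open>[0, b k)\<close> misses the hole and lies where the lower bound
  on the density holds; then \<open>[0, b (t + k))\<close> survives up to time \<open>t\<close>.
\<close>

lemma power_density_survival:
  assumes f: "integrable leb f" and H: "determined N H" "H \<noteq> {}" "H \<subseteq> J_elem \<gamma> n"
    and \<alpha>: "0 \<le> \<alpha>" "\<alpha> < 1" and "0 < x0"
    and lower: "0 < c" "\<And>x. 0 < x \<Longrightarrow> x < x0 \<Longrightarrow> c \<le> x powr \<alpha> * f x"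
    and upper: "0 < c'" "\<And>x. 0 < x \<Longrightarrow> x < 1 \<Longrightarrow> x powr \<alpha> * f x \<le> c'"
  shows "approx_equiv (\<lambda>t. measure (mu f) (survivors \<gamma> H t)) (\<lambda>t. real t powr (-((1 - \<alpha>) / \<gamma>)))"
proof -
  let ?f = "\<lambda>x::real. x powr (-\<alpha>)" and ?S = "survivors \<gamma> H"
  note [measurable] = determined_borel[OF H(1)]
  have S: "?S t \<in> sets borel" "?S t \<subseteq> II" for t
    by measurable (auto simp: survivors_eq)
  have cone: "lsv_cone ?f" by (rule cone_powr[OF \<alpha>])
  obtain C where C: "0 < C"
    "\<And>t. 1 \<le> t \<Longrightarrow> mass ?f (?S t) \<le> ennreal (C * real t powr (-((1 - \<alpha>) / \<gamma>)))"
    using powr_survival_upper[OF H(1,2) \<alpha>] by metis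
  have le: "emeasure (mu f) (?S t) \<le> ennreal (c' * C * real t powr (-((1 - \<alpha>) / \<gamma>)))" if "1 \<le> t" for t
  proof -
    have "emeasure (mu f) (?S t) \<le> mass (\<lambda>x. c' * ?f x) (?S t)"
      using upper(2) by (intro emeasure_mu_le f S) (simp add: powr_minus field_simps)
    also have "\<dots> = ennreal c' * mass ?f (?S t)"
      using upper(1) by (intro mass_cmult cone S) auto
    also have "\<dots> \<le> ennreal c' * ennreal (C * real t powr (-((1 - \<alpha>) / \<gamma>)))"
      by (intro mult_left_mono C that) auto
    finally show ?thesis using upper(1) C(1) by (simp add: ennreal_mult[symmetric] mult.assoc)
  qed
  obtain m where m: "b m \<le> x0" using b_small[OF \<open>0 < x0\<close>] .
  define k where "k = max m (Suc n)"
  have "b k \<le> b m" "b k \<le> b (Suc n)" by (auto simp: k_def intro: b_antimono)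
  hence k: "b k \<le> x0" "H \<inter> {..<b k} = {}" using m H(3) by (auto simp: J_elem_eq)
  define L where "L = ((2 * (real k + 2)) powr (-1/\<gamma>)) powr (1 - \<alpha>)"
  have "0 < L" by (simp add: L_def)
  have ge: "ennreal (c * L * real t powr (-((1 - \<alpha>) / \<gamma>))) \<le> emeasure (mu f) (?S t)" if "1 \<le> t" for t
  proof -
    define r where "r = b (t + k)"
    have r: "0 < r" "r \<le> 1" "r \<le> b k" by (auto simp: r_def b_pos b_le_1 intro: b_antimono)
    have "(2 * (real k + 2) * real t) powr (-1/\<gamma>) \<le> (2 * (real (t + k) + 1)) powr (-1/\<gamma>)"
    proof (rule powr_mono2')
      have "real k * 1 \<le> real k * real t" using that by (intro mult_left_mono) auto
      thus "2 * (real (t + k) + 1) \<le> 2 * (real k + 2) * real t"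
        using that by (simp add: algebra_simps)
    qed (use \<gamma>_pos in auto)
    also have "\<dots> = 2 powr (-1/\<gamma>) * (real (t + k) + 1) powr (-1/\<gamma>)" by (rule powr_mult)
    also have "\<dots> \<le> r" unfolding r_def by (rule b_ge)
    finally have "((2 * (real k + 2) * real t) powr (-1/\<gamma>)) powr (1 - \<alpha>) \<le> r powr (1 - \<alpha>)"
      using \<alpha> by (intro powr_mono2) auto
    also have "((2 * (real k + 2) * real t) powr (-1/\<gamma>)) powr (1 - \<alpha>) = L * real t powr (-((1 - \<alpha>) / \<gamma>))"
      unfolding L_def powr_mult[of "2 * (real k + 2)"] powr_mult[of "(2 * (real k + 2)) powr (-1/\<gamma>)"]
      by (simp add: powr_powr)
    finally have "ennreal (c * (L * real t powr (-((1 - \<alpha>) / \<gamma>)))) \<le> ennreal (c * r powr (1 - \<alpha>))"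
      using lower(1) by (intro ennreal_leI mult_left_mono) auto
    also have "\<dots> = ennreal c * ennreal (r powr (1 - \<alpha>))" using lower(1) by (simp add: ennreal_mult)
    also have "\<dots> \<le> ennreal c * mass ?f {..<r}"
      by (intro mult_left_mono mass_powr_ge \<alpha> r) auto
    also have "mass ?f {..<r} \<le> mass ?f {0..<r}" by (rule mass_mono) auto
    hence "ennreal c * mass ?f {..<r} \<le> ennreal c * mass ?f {0..<r}" by (rule mult_left_mono) auto
    also have "\<dots> = mass (\<lambda>x. c * ?f x) {0..<r}"
      using lower(1) by (intro mass_cmult[symmetric] cone) auto
    also have "\<dots> \<le> emeasure (mu f) (?S t)"
    proof (rule mass_le_emeasure_mu[OF f S])
      show "{0..<r} \<subseteq> ?S t" unfolding r_def by (rule survivors_near_0[OF k(2)])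
      show "c * x powr (-\<alpha>) \<le> f x" if "0 < x" "x \<in> {0..<r}" for x
        using lower(2)[of x] that r k by (simp add: powr_minus field_simps)
    qed
    finally show ?thesis by (simp add: mult.assoc)
  qed
  define D where "D = max (c' * C) (inverse (c * L))"
  have D: "0 < D" "c' * C \<le> D" using upper(1) C(1) by (auto simp: D_def less_max_iff_disj)
  have "inverse D \<le> inverse (inverse (c * L))"
    using lower(1) \<open>0 < L\<close> by (intro le_imp_inverse_le) (auto simp: D_def)
  hence D': "inverse D \<le> c * L" by simp
  show ?thesis unfolding approx_equiv_def
  proof (intro exI[of _ D] conjI allI impI)
    show "0 < D" by fact
    fix t :: nat assume t: "1 \<le> t"
    let ?v = "real t powr (-((1 - \<alpha>) / \<gamma>))"
    have fin: "emeasure (mu f) (?S t) = ennreal (measure (mu f) (?S t))"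
      using le[OF t] by (intro emeasure_eq_ennreal_measure) (auto simp: top_unique)
    have "inverse D * ?v \<le> c * L * ?v" using D' by (intro mult_right_mono) auto
    also have "\<dots> \<le> measure (mu f) (?S t)"
      using ge[OF t] unfolding fin by (subst (asm) ennreal_le_iff) auto
    finally show "inverse D * ?v \<le> measure (mu f) (?S t)" .
    have "measure (mu f) (?S t) \<le> c' * C * ?v"
      using le[OF t] upper(1) C(1) unfolding fin by (subst (asm) ennreal_le_iff) auto
    also have "\<dots> \<le> D * ?v" using D by (intro mult_right_mono) auto
    finally show "measure (mu f) (?S t) \<le> D * ?v" .
  qed
qed

end

lemma approx_equiv_powr_log_ratio:
  assumes "approx_equiv u (\<lambda>t. real t powr (-r))"
  shows "(\<lambda>t. ln (u t) / ln (real t)) \<longlonglongrightarrow> -r"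
proof -
  obtain C where C: "0 < C" "\<And>t. 1 \<le> t \<Longrightarrow> inverse C * real t powr (-r) \<le> u t"
    "\<And>t. 1 \<le> t \<Longrightarrow> u t \<le> C * real t powr (-r)"
    using assms unfolding approx_equiv_def by blast
  have inv: "(\<lambda>t. a / ln (real t)) \<longlonglongrightarrow> 0" for a
    by (intro tendsto_divide_0[OF tendsto_const] filterlim_at_top_imp_at_infinity
        filterlim_compose[OF ln_at_top filterlim_real_sequentially])
  have ev: "eventually (\<lambda>t::nat. t \<ge> 2) sequentially" by (rule eventually_ge_at_top)
  have bounds: "- ln C / ln (real t) - r \<le> ln (u t) / ln (real t) \<and>
      ln (u t) / ln (real t) \<le> ln C / ln (real t) - r" if t: "t \<ge> 2" for t
  proof -
    have pos: "0 < ln (real t)" "0 < inverse C * real t powr (-r)" using t C(1) by auto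
    have u: "0 < u t" using pos(2) C(2)[of t] t by linarith
    have "ln (inverse C * real t powr (-r)) \<le> ln (u t)"
      using C(2)[of t] pos u t by (subst ln_le_cancel_iff) auto
    moreover have "ln (u t) \<le> ln (C * real t powr (-r))"
      using C(3)[of t] u t C(1) by (subst ln_le_cancel_iff) auto
    ultimately have num: "- ln C - r * ln (real t) \<le> ln (u t)" "ln (u t) \<le> ln C - r * ln (real t)"
      using t C(1) by (auto simp: ln_mult ln_inverse ln_powr)
    have quot: "a / ln (real t) - r = (a - r * ln (real t)) / ln (real t)" for a
      using pos(1) by (simp add: field_simps)
    show ?thesis unfolding quot using num pos(1) by (intro conjI divide_right_mono) auto
  qed
  show ?thesis
  proof (rule tendsto_sandwich)
    show "eventually (\<lambda>t. - ln C / ln (real t) - r \<le> ln (u t) / ln (real t)) sequentially"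
      by (rule eventually_mono[OF ev]) (rule conjunct1[OF bounds])
    show "eventually (\<lambda>t. ln (u t) / ln (real t) \<le> ln C / ln (real t) - r) sequentially"
      by (rule eventually_mono[OF ev]) (rule conjunct2[OF bounds])
    show "(\<lambda>t. - ln C / ln (real t) - r) \<longlonglongrightarrow> -r" "(\<lambda>t. ln C / ln (real t) - r) \<longlonglongrightarrow> -r"
      using tendsto_diff[OF inv[of "- ln C"] tendsto_const[of r]]
        tendsto_diff[OF inv[of "ln C"] tendsto_const[of r]] by simp_all
  qed
qed

theorem theorem2p1:
  fixes \<gamma> \<alpha> x0 :: real and H :: "real set" and l\<^sub>H :: nat and f :: "real \<Rightarrow> real"
  assumes "0 < \<gamma>" and "\<gamma> < 1"
    and "H \<in> part_Jt \<gamma> l\<^sub>H"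
    and "integrable leb f"
    and "\<forall>x\<in>II. 0 \<le> f x"
    and "x0 \<in> {0<..<1}"
    and "\<alpha> \<in> {0..<1}"
    and "0 < (INF x\<in>{0<..<x0}. ereal (x powr \<alpha> * f x))"
    and "(INF x\<in>{0<..<x0}. ereal (x powr \<alpha> * f x)) \<le> (SUP x\<in>{0<..<1}. ereal (x powr \<alpha> * f x))"
    and "(SUP x\<in>{0<..<1}. ereal (x powr \<alpha> * f x)) < \<infinity>"
  shows "approx_equiv (\<lambda>t. measure (mu f) (survivors \<gamma> H t))
           (\<lambda>t. real t powr (- ((1 - \<alpha>) / \<gamma>)))
    \<and> has_escape_rate \<gamma> H (mu f)
    \<and> e_poly \<gamma> H (mu f) = (1 - \<alpha>) / \<gamma>"
proof -
  interpret neutral_map \<gamma> by unfold_locales fact+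
  obtain N n where H: "determined N H" "H \<noteq> {}" "H \<subseteq> J_elem \<gamma> n"
    using part_Jt_determined[OF assms(3)] .
  obtain c where c: "0 < ereal c" "ereal c < (INF x\<in>{0<..<x0}. ereal (x powr \<alpha> * f x))"
    using ereal_dense2[OF assms(8)] by blast
  obtain d where d: "(SUP x\<in>{0<..<1}. ereal (x powr \<alpha> * f x)) < ereal d"
    using ereal_dense2[OF assms(10)] by blast
  have approx: "approx_equiv (\<lambda>t. measure (mu f) (survivors \<gamma> H t))
           (\<lambda>t. real t powr (- ((1 - \<alpha>) / \<gamma>)))"
  proof (rule power_density_survival[OF assms(4) H])
    show "c \<le> x powr \<alpha> * f x" if "0 < x" "x < x0" for x
    proof -
      have "(INF x\<in>{0<..<x0}. ereal (x powr \<alpha> * f x)) \<le> ereal (x powr \<alpha> * f x)"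
        using that by (intro INF_lower) auto
      with c(2) have "ereal c < ereal (x powr \<alpha> * f x)" by (rule less_le_trans)
      thus ?thesis by simp
    qed
    show "x powr \<alpha> * f x \<le> max 1 d" if "0 < x" "x < 1" for x
    proof -
      have "ereal (x powr \<alpha> * f x) \<le> (SUP x\<in>{0<..<1}. ereal (x powr \<alpha> * f x))"
        using that by (intro SUP_upper) auto
      hence "ereal (x powr \<alpha> * f x) < ereal d" using d by (rule le_less_trans)
      thus ?thesis by simp
    qed
  qed (use assms(6,7) c(1) in auto)
  have lim: "log_ratio \<gamma> H (mu f) \<longlonglongrightarrow> - ((1 - \<alpha>) / \<gamma>)"
    unfolding log_ratio_def [abs_def] by (rule approx_equiv_powr_log_ratio[OF approx])
  show ?thesis
    using approx convergentI[OF lim] limI[OF lim] by (simp add: has_escape_rate_def e_poly_def)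
qed

end
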